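(* Let $n,n'$ be positive integers, let $A=(A_{ij})$ be an $n\times n$ matrix, $B=(B_{i'j'})$ an $n'\times n'$ matrix, $U=(U_{i'j})$ an $n'\times n$ matrix and $V=(V_{ij'})$ an $n\times n'$ matrix. Put $$\widehat B=B-\mathrm{diag}\,B+U(I-A)^{-1}V,$$ where $\mathrm{diag}\,B$ is the diagonal matrix with entries $(\mathrm{diag}\,B)_{i'j'}=B_{i'i'}\delta_{i'j'}$. Then $$\sum_{\mathbf r\in\mathbb{Z}_{\ge0}^n}\frac{1}{\mathbf r!}\,\mathrm{dperm}_{\beta}\begin{bmatrix} B & U(n^{\mathbf r})\\ V(n^{\mathbf r}) & A(n^{\mathbf r},n^{\mathbf r})\end{bmatrix}=\frac{e^{-\beta\,\mathrm{Tr}A}\cdot\mathrm{perm}_{\beta}\,\widehat B}{\det(I-A)^{\beta}}.$$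
   Context: Extended permanents: for a square matrix $M=(M_{xy})$ indexed by a finite set $X$, $\mathrm{perm}_\beta M=\sum_{\pi}\beta^{C(\pi)}\prod_{x\in X}M_{x\pi(x)}$, where the sum is over all permutations $\pi$ of $X$ and $C(\pi)$ is the number of cycles of $\pi$ (fixed points count as cycles of length 1); $\mathrm{dperm}_\beta M$ is the same sum restricted to derangements $\pi$ of $X$ (permutations with no fixed points). Multisets: for $\mathbf r=(r_1,\ldots,r_n)\in\mathbb{Z}_{\ge0}^n$ put $\mathbf r!=r_1!\cdots r_n!$, $N=r_1+\cdots+r_n$, and let $n^{\mathbf r}=\{1_1,\ldots,1_{r_1},\ldots,n_1,\ldots,n_{r_n}\}$ be the multiset of size $N$ in which the index $i$ is repeated $r_i$ times; the labelled copies $i_a$ ($1\le a\le r_i$) are treated as $N$ distinct indices (so a derangement may send $i_a$ to $i_b$ with $a\ne b$). $A(n^{\mathbf r},n^{\mathbf r})$ is the $N\times N$ matrix indexed by $n^{\mathbf r}$ with $(i_a,j_b)$ entry $A_{ij}$; $U(n^{\mathbf r})$ is the $n'\times N$ matrix with $(i',j_b)$ entry $U_{i'j}$; $V(n^{\mathbf r})$ is the $N\times n'$ matrix with $(i_a,j')$ entry $V_{ij'}$. The block matrix is $(n'+N)\times(n'+N)$, indexed by $\{1',\ldots,n'\}\cup n^{\mathbf r}$; for $\mathbf r=(0,\ldots,0)$ it is just $B$. Interpretation: $\beta$ and the entries of $A,B,U,V$ are commuting indeterminates and the identity is one of formal power series with rational coefficients in them; $(I-A)^{-1}=\sum_{k\ge0}A^k$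 and $\det(I-A)^{-\beta}$ means $\exp\left(\beta\sum_{t\ge1}\frac1t\mathrm{Tr}(A^t)\right)$. $I$ is the identity matrix. *)

theory Defs
  imports
    "HOL-Analysis.Analysis"
    "HOL-Library.Multiset"
    "HOL-Combinatorics.Permutations"
    "HOL-Combinatorics.Orbits"
begin

section \<open>Multivariate formal power series\<close>

text \<open>
  A monomial in the commuting indeterminates \<open>'v\<close> is a finite multiset over \<open>'v\<close> (its degree is the
  size of the multiset, and multiplication of monomials is the sum of multisets); a formal power
  series is an arbitrary coefficient function on monomials.
\<close>

typedef ('v, 'a) mfps = "UNIV :: ('v multiset \<Rightarrow> 'a) set"
  morphisms mfps_nth Abs_mfps
  by simp

setup_lifting type_definition_mfps

lemma mfps_nth_Abs_mfps [simp]: "mfps_nth (Abs_mfps f) m = f m"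
  by (simp add: Abs_mfps_inverse)

lemma mfps_eqI: "(\<And>m. mfps_nth f m = mfps_nth g m) \<Longrightarrow> f = g"
  by (metis mfps_nth_inject ext)

lemma finite_mset_subsets: "finite {a. a \<subseteq># m}"
proof (induction m)
  case (add x m)
  have "{a. a \<subseteq># add_mset x m} \<subseteq> {a. a \<subseteq># m} \<union> add_mset x ` {a. a \<subseteq># m}"
  proof
    fix a assume "a \<in> {a. a \<subseteq># add_mset x m}"
    then have a: "a \<subseteq># add_mset x m" by simp
    show "a \<in> {a. a \<subseteq># m} \<union> add_mset x ` {a. a \<subseteq># m}"
    proof (cases "x \<in># a")
      case True
      then obtain b where "a = add_mset x b" by (metis mset_add)
      then have "b \<subseteq># m" using a by simp
      then show ?thesis using \<open>a = add_mset x b\<close> by blast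
    next
      case False
      have "count a y \<le> count m y" for y
        using mset_subset_eq_count [OF a, of y] False by (cases "y = x") (auto simp: not_in_iff)
      then show ?thesis by (simp add: mset_subset_eqI)
    qed
  qed
  then show ?case by (rule finite_subset) (simp add: add)
qed simp

lemma finite_mset_decomps: "finite {(a, b). a + b = (m :: 'v multiset)}"
proof (rule finite_subset)
  show "{(a, b). a + b = m} \<subseteq> {a. a \<subseteq># m} \<times> {a. a \<subseteq># m}" by auto
qed (simp add: finite_mset_subsets)

instantiation mfps :: (type, comm_ring_1) comm_ring_1
begin

lift_definition zero_mfps :: "('a, 'b) mfps" is "\<lambda>_. 0" .
lift_definition one_mfps :: "('a, 'b) mfps" is "\<lambda>m. if m = {#} then 1 else 0" .
lift_definition plus_mfps :: "('a, 'b) mfps \<Rightarrow> ('a, 'b) mfps \<Rightarrow> ('a, 'b) mfps"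
  is "\<lambda>f g m. f m + g m" .
lift_definition minus_mfps :: "('a, 'b) mfps \<Rightarrow> ('a, 'b) mfps \<Rightarrow> ('a, 'b) mfps"
  is "\<lambda>f g m. f m - g m" .
lift_definition uminus_mfps :: "('a, 'b) mfps \<Rightarrow> ('a, 'b) mfps"
  is "\<lambda>f m. - f m" .
lift_definition times_mfps :: "('a, 'b) mfps \<Rightarrow> ('a, 'b) mfps \<Rightarrow> ('a, 'b) mfps"
  is "\<lambda>f g m. \<Sum>(a, b)\<in>{(a, b). a + b = m}. f a * g b" .

instance
proof
  fix f g h :: "('a, 'b) mfps"
  show "f * g * h = f * (g * h)"
  proof (rule mfps_eqI)
    fix m :: "'a multiset"
    have "mfps_nth (f * g * h) m =
        (\<Sum>p\<in>{(a, b). a + b = m}. \<Sum>q\<in>{(a, b). a + b = fst p}.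
          mfps_nth f (fst q) * mfps_nth g (snd q) * mfps_nth h (snd p))"
      by (simp add: times_mfps.rep_eq case_prod_unfold sum_distrib_right)
    also have "\<dots> = (\<Sum>(p, q)\<in>Sigma {(a, b). a + b = m} (\<lambda>p. {(a, b). a + b = fst p}).
          mfps_nth f (fst q) * mfps_nth g (snd q) * mfps_nth h (snd p))"
      by (rule sum.Sigma) (auto intro: finite_mset_decomps)
    also have "\<dots> = (\<Sum>(p, q)\<in>Sigma {(a, b). a + b = m} (\<lambda>p. {(a, b). a + b = snd p}).
          mfps_nth f (fst p) * (mfps_nth g (fst q) * mfps_nth h (snd q)))"
      by (rule sum.reindex_bij_witness
          [where i = "\<lambda>((a, x), (b, c)). ((a + b, c), (a, b))"
             and j = "\<lambda>((x, c), (a, b)). ((a, b + c), (b, c))"])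
        (auto simp: ac_simps)
    also have "\<dots> = (\<Sum>p\<in>{(a, b). a + b = m}. \<Sum>q\<in>{(a, b). a + b = snd p}.
          mfps_nth f (fst p) * (mfps_nth g (fst q) * mfps_nth h (snd q)))"
      by (rule sum.Sigma [symmetric]) (auto intro: finite_mset_decomps)
    also have "\<dots> = mfps_nth (f * (g * h)) m"
      by (simp add: times_mfps.rep_eq case_prod_unfold sum_distrib_left)
    finally show "mfps_nth (f * g * h) m = mfps_nth (f * (g * h)) m" .
  qed
  show "f * g = g * f"
  proof (rule mfps_eqI)
    fix m :: "'a multiset"
    show "mfps_nth (f * g) m = mfps_nth (g * f) m"
      unfolding times_mfps.rep_eq
      by (rule sum.reindex_bij_witness [where i = prod.swap and j = prod.swap])
        (auto simp: ac_simps)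
  qed
  show "1 * f = f"
  proof (rule mfps_eqI)
    fix m :: "'a multiset"
    have "mfps_nth (1 * f) m =
        (\<Sum>p\<in>{(a, b). a + b = m}. if p = ({#}, m) then mfps_nth f m else 0)"
      unfolding times_mfps.rep_eq one_mfps.rep_eq by (rule sum.cong) (auto split: if_splits)
    also have "\<dots> = mfps_nth f m"
      by (subst sum.delta) (auto simp: finite_mset_decomps)
    finally show "mfps_nth (1 * f) m = mfps_nth f m" .
  qed
  show "(f + g) * h = f * h + g * h"
    by (rule mfps_eqI)
      (simp add: times_mfps.rep_eq plus_mfps.rep_eq case_prod_unfold distrib_right sum.distrib)
  show "f + g + h = f + (g + h)" "f + g = g + f" "0 + f = f" "- f + f = 0" "f - g = f + - g"
    by (auto intro!: mfps_eqI
        simp: plus_mfps.rep_eq zero_mfps.rep_eq uminus_mfps.rep_eq minus_mfps.rep_eq)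
  show "(0 :: ('a, 'b) mfps) \<noteq> 1"
    by (metis one_mfps.rep_eq zero_mfps.rep_eq zero_neq_one)
qed

end

lift_definition mfps_const :: "'a \<Rightarrow> ('v, 'a :: zero) mfps"
  is "\<lambda>c m. if m = {#} then c else 0" .

lift_definition mfps_var :: "'v \<Rightarrow> ('v, 'a :: zero_neq_one) mfps"
  is "\<lambda>v m. if m = {#v#} then 1 else 0" .


subsection \<open>Infinite sums\<close>

text \<open>
  Formal power series carry the usual topology of coefficientwise convergence, each coefficient being
  discrete. As shown by \<open>has_sum_mfps_iff\<close> below, summability in this topology is local finiteness of
  the family, and the sum is taken coefficient by coefficient.
\<close>

instantiation mfps :: (type, type) t2_space
begin

definition open_mfps :: "('a, 'b) mfps set \<Rightarrow> bool" where
  "open_mfps S \<longleftrightarrow> (\<forall>f\<in>S. \<exists>M. finite M \<and>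
     (\<forall>g. (\<forall>m\<in>M. mfps_nth g m = mfps_nth f m) \<longrightarrow> g \<in> S))"

instance
proof
  show "open (UNIV :: ('a, 'b) mfps set)"
    by (auto simp: open_mfps_def)
next
  fix S T :: "('a, 'b) mfps set"
  assume S: "open S" and T: "open T"
  show "open (S \<inter> T)"
    unfolding open_mfps_def
  proof
    fix f assume f: "f \<in> S \<inter> T"
    obtain M where "finite M" "\<forall>g. (\<forall>m\<in>M. mfps_nth g m = mfps_nth f m) \<longrightarrow> g \<in> S"
      using S f unfolding open_mfps_def by blast
    moreover obtain M' where "finite M'" "\<forall>g. (\<forall>m\<in>M'. mfps_nth g m = mfps_nth f m) \<longrightarrow> g \<in> T"
      using T f unfolding open_mfps_def by blast
    ultimately show "\<exists>M. finite M \<and> (\<forall>g. (\<forall>m\<in>M. mfps_nth g m = mfps_nth f m) \<longrightarrow> g \<in> S \<inter> T)"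
      by (intro exI [of _ "M \<union> M'"]) auto
  qed
next
  fix K :: "('a, 'b) mfps set set"
  assume "\<forall>S\<in>K. open S"
  then show "open (\<Union>K)"
    unfolding open_mfps_def by (meson Union_iff)
next
  fix f g :: "('a, 'b) mfps"
  assume "f \<noteq> g"
  then obtain m where m: "mfps_nth f m \<noteq> mfps_nth g m"
    using mfps_eqI by blast
  have "open {h. mfps_nth h m = c}" for c :: 'b
    unfolding open_mfps_def by (intro ballI exI [of _ "{m}"]) auto
  then show "\<exists>U V. open U \<and> open V \<and> f \<in> U \<and> g \<in> V \<and> U \<inter> V = {}"
    using m by (intro exI [of _ "{h. mfps_nth h m = mfps_nth f m}"]
        exI [of _ "{h. mfps_nth h m = mfps_nth g m}"]) auto
qed

end

lemma tendsto_mfps_iff: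
  "(F \<longlongrightarrow> f) net \<longleftrightarrow> (\<forall>m. \<forall>\<^sub>F x in net. mfps_nth (F x) m = mfps_nth f m)"
proof
  assume F: "(F \<longlongrightarrow> f) net"
  show "\<forall>m. \<forall>\<^sub>F x in net. mfps_nth (F x) m = mfps_nth f m"
  proof
    fix m
    have "open {h. mfps_nth h m = mfps_nth f m}"
      unfolding open_mfps_def by (intro ballI exI [of _ "{m}"]) auto
    from topological_tendstoD [OF F this]
    show "\<forall>\<^sub>F x in net. mfps_nth (F x) m = mfps_nth f m" by simp
  qed
next
  assume *: "\<forall>m. \<forall>\<^sub>F x in net. mfps_nth (F x) m = mfps_nth f m"
  show "(F \<longlongrightarrow> f) net"
  proof (rule topological_tendstoI)
    fix S assume "open S" "f \<in> S"
    then obtain M where M: "finite M" "\<forall>g. (\<forall>m\<in>M. mfps_nth g m = mfps_nth f m) \<longrightarrow> g \<in> S"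
      unfolding open_mfps_def by blast
    have "\<forall>\<^sub>F x in net. \<forall>m\<in>M. mfps_nth (F x) m = mfps_nth f m"
      using M(1) * by (simp add: eventually_ball_finite)
    then show "\<forall>\<^sub>F x in net. F x \<in> S"
      by eventually_elim (use M(2) in auto)
  qed
qed

lemma mfps_nth_sum: "mfps_nth (sum f X) m = (\<Sum>x\<in>X. mfps_nth (f x) m)"
  by (induction X rule: infinite_finite_induct) (auto simp: zero_mfps.rep_eq plus_mfps.rep_eq)

lemma has_sum_mfps_iff:
  fixes f :: "'i \<Rightarrow> ('v, 'a :: comm_ring_1) mfps"
  shows "(f has_sum s) S \<longleftrightarrow>
    (\<forall>m. finite {i\<in>S. mfps_nth (f i) m \<noteq> 0} \<and>
         mfps_nth s m = (\<Sum>i\<in>{i\<in>S. mfps_nth (f i) m \<noteq> 0}. mfps_nth (f i) m))"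
proof -
  have "(\<forall>\<^sub>F X in finite_subsets_at_top S. mfps_nth (sum f X) m = mfps_nth s m) \<longleftrightarrow>
      finite {i\<in>S. mfps_nth (f i) m \<noteq> 0} \<and>
      mfps_nth s m = (\<Sum>i\<in>{i\<in>S. mfps_nth (f i) m \<noteq> 0}. mfps_nth (f i) m)" for m
  proof -
    define c where "c i = mfps_nth (f i) m" for i
    define Z where "Z = {i\<in>S. c i \<noteq> 0}"
    have sum_Z: "sum c Y = sum c Z" if "finite Y" "Z \<subseteq> Y" "Y \<subseteq> S" for Y
      by (rule sum.mono_neutral_right) (use that in \<open>auto simp: Z_def\<close>)
    have "(\<forall>\<^sub>F X in finite_subsets_at_top S. sum c X = mfps_nth s m) \<longleftrightarrow>
        finite Z \<and> mfps_nth s m = sum c Z"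
    proof
      assume "\<forall>\<^sub>F X in finite_subsets_at_top S. sum c X = mfps_nth s m"
      then obtain X where X: "finite X" "X \<subseteq> S"
        and eq: "\<And>Y. finite Y \<and> X \<subseteq> Y \<and> Y \<subseteq> S \<Longrightarrow> sum c Y = mfps_nth s m"
        unfolding eventually_finite_subsets_at_top by meson
      have "i \<in> X" if "i \<in> Z" for i
      proof (rule ccontr)
        assume i: "i \<notin> X"
        have "sum c (insert i X) = sum c X"
          using eq [of "insert i X"] eq [of X] X that by (auto simp: Z_def)
        then show False using i X that by (simp add: Z_def)
      qed
      then have "Z \<subseteq> X" by blast
      then show "finite Z \<and> mfps_nth s m = sum c Z"
        using eq [of X] X sum_Z [of X] finite_subset by auto
    next
      assume *: "finite Z \<and> mfps_nth s m = sum c Z"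
      have "Z \<subseteq> S" by (auto simp: Z_def)
      with * show "\<forall>\<^sub>F X in finite_subsets_at_top S. sum c X = mfps_nth s m"
        unfolding eventually_finite_subsets_at_top by (metis sum_Z)
    qed
    then show ?thesis
      unfolding mfps_nth_sum Z_def c_def .
  qed
  then show ?thesis
    by (simp only: has_sum_def tendsto_mfps_iff)
qed

text \<open>
  The infinite sums in \<open>mfps_exp\<close>, \<open>matrix_geom_series\<close> and \<open>det_neg_power\<close> converge whenever the constant
  terms involved vanish: see the lemmas \<open>summable_mfps_exp\<close>, \<open>summable_matrix_geom_series\<close> and
  \<open>summable_trace_series\<close> below.
\<close>

definition mfps_exp :: "('v, 'a :: field_char_0) mfps \<Rightarrow> ('v, 'a) mfps" where
  "mfps_exp f = (\<Sum>\<^sub>\<infinity>k. mfps_const (1 / fact k) * f ^ k)"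


section \<open>Matrices of formal power series\<close>

text \<open>
  The library's \<open>A ^ k\<close> on matrices is the entrywise power, hence a separate definition.
\<close>

primrec matrix_pow :: "'a :: semiring_1 ^ 'n ^ 'n \<Rightarrow> nat \<Rightarrow> 'a ^ 'n ^ 'n" where
  "matrix_pow A 0 = mat 1"
| "matrix_pow A (Suc k) = A ** matrix_pow A k"

definition matrix_geom_series ::
    "('v, 'a :: comm_ring_1) mfps ^ 'n ^ 'n \<Rightarrow> ('v, 'a) mfps ^ 'n ^ 'n" where
  "matrix_geom_series A = (\<chi> i j. \<Sum>\<^sub>\<infinity>k. matrix_pow A k $ i $ j)"

text \<open>The formal power series \<open>det (I - A) powr (- \<beta>)\<close>.\<close>

definition det_neg_power ::
    "('v, 'a :: field_char_0) mfps \<Rightarrow> ('v, 'a) mfps ^ 'n ^ 'n \<Rightarrow> ('v, 'a) mfps" where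
  "det_neg_power \<beta> A =
     mfps_exp (\<beta> * (\<Sum>\<^sub>\<infinity>t\<in>{1..}. mfps_const (1 / of_nat t) * trace (matrix_pow A t)))"

definition diag_part :: "'a :: zero ^ 'n ^ 'n \<Rightarrow> 'a ^ 'n ^ 'n" where
  "diag_part B = (\<chi> i j. if i = j then B $ i $ i else 0)"


subsection \<open>Convergence\<close>

definition mfps_order_ge :: "nat \<Rightarrow> ('v, 'a :: zero) mfps \<Rightarrow> bool" where
  "mfps_order_ge d f \<longleftrightarrow> (\<forall>m. size m < d \<longrightarrow> mfps_nth f m = 0)"

lemma mfps_order_ge_0 [simp]: "mfps_order_ge 0 f"
  by (simp add: mfps_order_ge_def)

lemma mfps_order_ge_1_iff: "mfps_order_ge (Suc 0) f \<longleftrightarrow> mfps_nth f {#} = 0"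
  by (auto simp: mfps_order_ge_def)

lemma mfps_order_ge_mult:
  assumes "mfps_order_ge d f" "mfps_order_ge e g"
  shows "mfps_order_ge (d + e) (f * g)"
  unfolding mfps_order_ge_def
proof (intro allI impI)
  fix m :: "'a multiset" assume m: "size m < d + e"
  have "mfps_nth f a * mfps_nth g b = 0" if "a + b = m" for a b
  proof (cases "size a < d")
    case False
    then have "size b < e" using that m by auto
    then show ?thesis using assms(2) by (simp add: mfps_order_ge_def)
  qed (use assms(1) in \<open>simp add: mfps_order_ge_def\<close>)
  then show "mfps_nth (f * g) m = 0"
    unfolding times_mfps.rep_eq by (intro sum.neutral) auto
qed

lemma mfps_order_ge_sum: "(\<And>x. x \<in> X \<Longrightarrow> mfps_order_ge d (f x)) \<Longrightarrow> mfps_order_ge d (sum f X)"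
  by (simp add: mfps_order_ge_def mfps_nth_sum)

lemma mfps_order_ge_power: "mfps_order_ge (Suc 0) f \<Longrightarrow> mfps_order_ge k (f ^ k)"
proof (induction k)
  case (Suc k)
  then show ?case using mfps_order_ge_mult [of "Suc 0" f k "f ^ k"] by simp
qed simp

lemma mfps_order_ge_const_mult: "mfps_order_ge d f \<Longrightarrow> mfps_order_ge d (mfps_const c * f)"
  using mfps_order_ge_mult [of 0 "mfps_const c" d f] by simp

lemma mfps_order_ge_matrix_pow:
  "(\<And>i j. mfps_order_ge (Suc 0) (A $ i $ j)) \<Longrightarrow> mfps_order_ge k (matrix_pow A k $ i $ j)"
proof (induction k arbitrary: i j)
  case (Suc k)
  have "mfps_order_ge (Suc 0 + k) (A $ i $ l * matrix_pow A k $ l $ j)" for l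
    by (intro mfps_order_ge_mult Suc)
  then show ?case by (auto simp: matrix_matrix_mult_def intro: mfps_order_ge_sum)
qed simp

lemma summable_mfps_order:
  fixes f :: "nat \<Rightarrow> ('v, 'a :: comm_ring_1) mfps"
  assumes "\<And>k. mfps_order_ge k (f k)"
  shows "f summable_on S"
proof -
  have "k \<le> size m" if "mfps_nth (f k) m \<noteq> 0" for k m
    using assms [of k] that unfolding mfps_order_ge_def by (meson not_le)
  then have "{k \<in> S. mfps_nth (f k) m \<noteq> 0} \<subseteq> {..size m}" for m
    by blast
  then have "finite {k \<in> S. mfps_nth (f k) m \<noteq> 0}" for m
    by (rule finite_subset) (rule finite_atMost)
  then have "(f has_sum Abs_mfps (\<lambda>m. \<Sum>k\<in>{k\<in>S. mfps_nth (f k) m \<noteq> 0}. mfps_nth (f k) m)) S"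
    unfolding has_sum_mfps_iff mfps_nth_Abs_mfps by blast
  then show ?thesis by (rule has_sum_imp_summable)
qed

lemma summable_mfps_exp:
  "mfps_nth f {#} = 0 \<Longrightarrow> (\<lambda>k. mfps_const (1 / fact k) * f ^ k) summable_on UNIV"
  by (rule summable_mfps_order, rule mfps_order_ge_const_mult, rule mfps_order_ge_power)
    (simp add: mfps_order_ge_1_iff)

lemma summable_matrix_geom_series:
  "(\<And>i j. mfps_nth (A $ i $ j) {#} = 0) \<Longrightarrow> (\<lambda>k. matrix_pow A k $ i $ j) summable_on UNIV"
  by (rule summable_mfps_order, rule mfps_order_ge_matrix_pow) (simp add: mfps_order_ge_1_iff)

lemma summable_trace_series:
  "(\<And>i j. mfps_nth (A $ i $ j) {#} = 0) \<Longrightarrow>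
    (\<lambda>t. mfps_const (1 / of_nat t) * trace (matrix_pow A t)) summable_on {1..}"
  unfolding trace_def
  by (rule summable_mfps_order, rule mfps_order_ge_const_mult, rule mfps_order_ge_sum,
      rule mfps_order_ge_matrix_pow) (simp add: mfps_order_ge_1_iff)


section \<open>Extended permanents\<close>

definition num_cycles :: "'x set \<Rightarrow> ('x \<Rightarrow> 'x) \<Rightarrow> nat" where
  "num_cycles X \<pi> = card (orbit \<pi> ` X)"

definition ext_perm :: "'a :: comm_ring_1 \<Rightarrow> 'x set \<Rightarrow> ('x \<Rightarrow> 'x \<Rightarrow> 'a) \<Rightarrow> 'a" where
  "ext_perm \<beta> X M = (\<Sum>\<pi> | \<pi> permutes X. \<beta> ^ num_cycles X \<pi> * (\<Prod>x\<in>X. M x (\<pi> x)))"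

definition ext_dperm :: "'a :: comm_ring_1 \<Rightarrow> 'x set \<Rightarrow> ('x \<Rightarrow> 'x \<Rightarrow> 'a) \<Rightarrow> 'a" where
  "ext_dperm \<beta> X M =
     (\<Sum>\<pi> | \<pi> permutes X \<and> (\<forall>x\<in>X. \<pi> x \<noteq> x). \<beta> ^ num_cycles X \<pi> * (\<Prod>x\<in>X. M x (\<pi> x)))"

text \<open>
  The index \<open>i'\<close> of \<open>B\<close> is \<open>Inl i'\<close>, and the labelled copy \<open>j\<^sub>b\<close> of \<open>j\<close> is \<open>Inr (j, b)\<close>.
\<close>

definition block_index :: "('n \<Rightarrow> nat) \<Rightarrow> ('m + 'n \<times> nat) set" where
  "block_index r = UNIV <+> (SIGMA i:UNIV. {1..r i})"

fun block_matrix ::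
    "'a ^ 'm ^ 'm \<Rightarrow> 'a ^ 'n ^ 'm \<Rightarrow> 'a ^ 'm ^ 'n \<Rightarrow> 'a ^ 'n ^ 'n
      \<Rightarrow> 'm + 'n \<times> nat \<Rightarrow> 'm + 'n \<times> nat \<Rightarrow> 'a" where
  "block_matrix B U V A (Inl i) (Inl j) = B $ i $ j"
| "block_matrix B U V A (Inl i) (Inr (j, b)) = U $ i $ j"
| "block_matrix B U V A (Inr (i, a)) (Inl j) = V $ i $ j"
| "block_matrix B U V A (Inr (i, a)) (Inr (j, b)) = A $ i $ j"


section \<open>The indeterminates\<close>

datatype ('n, 'm) indet =
  Beta | Ent_A 'n 'n | Ent_B 'm 'm | Ent_U 'm 'n | Ent_V 'n 'm

end

theory Submission
  imports Defs
begin

text \<open>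
  In a derangement of the indices of \<open>B\<close>, called primed indices, together with the labelled copies,
  bypassing the copies in every cycle that meets a primed index leaves a permutation of the primed
  indices, and its edges from \<open>x\<close> to \<open>y\<close> carry the total weight of \<open>B\<close> off the diagonal plus \<open>U A\<^sup>k V\<close>
  for all \<open>k\<close>, which is the entry of \<open>Bhat\<close>. The remaining cycles run through copies only; by the
  exponential formula they contribute \<open>exp (\<beta> (\<Sum>t\<ge>2. Tr (A\<^sup>t) / t))\<close>, where \<open>t = 1\<close> is missing because copies
  may not be fixed, and this is \<open>exp (- \<beta> Tr A)\<close> times \<open>det (I - A)\<close> to the power \<open>- \<beta>\<close>. The factor
  \<open>1 / r!\<close> removes the labelling. The proof below replaces both bijections by short algebraic arguments.

  Cycles through primed indices. Clear the diagonal of \<open>B\<close>, so that the primed indices may formally be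
  fixed, and let \<open>S\<close> be the sum on the left. As a function of the row \<open>(b, u)\<close> of one primed index \<open>x\<close> (the entries of \<open>B\<close> and of \<open>U\<close>), it is
  linear. If \<open>x\<close> is mapped to a copy of colour \<open>j\<close>, bypassing this copy keeps the number of cycles and
  turns the row of \<open>x\<close> into the row \<open>(V\<^sub>j, A\<^sub>j)\<close> of \<open>j\<close> (\<open>partial_dperm_contract\<close>). The \<open>r\<^sub>j\<close> copies of this
  colour contribute equally, and \<open>r\<^sub>j / r!\<close> is the reciprocal factorial of the decreased multiplicities.
  Hence \<open>S(b, u) = S(b, 0) + S(u V, u A)\<close> (\<open>copy_sum_step\<close>). For \<open>b = 0\<close> linearity turns this into
  \<open>S(0, w - w A) = S(w V, 0)\<close>, and with \<open>w = u (I - A)\<^sup>-\<^sup>1\<close> the copies disappear from the row of \<open>x\<close>: it becomes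
  \<open>b + u (I - A)\<^sup>-\<^sup>1 V\<close>. After all rows have been treated, the matrix is block triangular, and \<open>S\<close> is the
  product of \<open>perm\<^sub>\<beta> Bhat\<close> and of the sum \<open>S\<^sub>0\<close> without primed indices (\<open>copy_sum_factor\<close>).

  Cycles through copies only. Let \<open>D\<close> be the Euler operator that multiplies each monomial by its degree
  in the entries of \<open>A\<close>. On the term of \<open>S\<^sub>0\<close> with multiplicities \<open>r\<close> it acts as multiplication by \<open>\<Sum>i. r\<^sub>i\<close>,
  and \<open>r\<^sub>i / r!\<close> amounts to marking one copy of colour \<open>i\<close>. A marked copy is a primed index with row and
  column taken from \<open>A\<close> that may not be fixed, so the first part applies to it and gives
  \<open>D S\<^sub>0 = \<beta> Tr (A (I - A)\<^sup>-\<^sup>1 A) S\<^sub>0\<close> (\<open>copy_sum_empty_ode\<close>). The product of the two exponentials satisfies the same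
  equation, because \<open>D (Tr (A\<^sup>t)) = t Tr (A\<^sup>t)\<close> (\<open>det_side_ode\<close>). Both series are \<open>1\<close> in degree zero, so they agree
  (\<open>euler_ode_unique\<close>).
\<close>

section \<open>Cycles under contraction of an edge\<close>

text \<open>
  The permutation \<open>\<pi> \<circ> (x z)\<close> inserts the new point \<open>z\<close> into the cycle of \<open>x\<close>, right after \<open>x\<close>; every cycle
  keeps its old points.
\<close>

lemma orbit_contract:
  assumes "\<pi> permutes S" "finite S" "x \<in> S" "z \<notin> S" "y \<in> S"
  shows "orbit (\<pi> \<circ> Transposition.transpose x z) y - {z} = orbit \<pi> y"
proof -
  let ?\<sigma> = "\<pi> \<circ> Transposition.transpose x z"
  have perm: "permutation \<pi>" using assms(1,2) permutation_permutes by blast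
  have \<pi>z: "\<pi> z = z" using assms(1,4) permutes_not_in by metis
  have \<sigma>x: "?\<sigma> x = z" and \<sigma>z: "?\<sigma> z = \<pi> x" by (simp_all add: \<pi>z)
  have \<sigma>: "?\<sigma> w = \<pi> w" if "w \<noteq> x" "w \<noteq> z" for w using that by (simp add: transpose_apply_other)
  have sub: "orbit \<pi> y \<subseteq> S" using assms(1,5) permutes_orbit_subset by fast
  have self: "y \<in> orbit \<pi> y" using perm by (rule permutation_self_in_orbit)
  have "(w \<noteq> z \<longrightarrow> w \<in> orbit \<pi> y) \<and> (w = z \<longrightarrow> x \<in> orbit \<pi> y)" if "w \<in> orbit ?\<sigma> y" for w
    using that
  proof induction
    case base
    show ?case
    proof (cases "y = x")
      case True
      then show ?thesis using self \<sigma>x by auto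
    next
      case False
      have "?\<sigma> y = \<pi> y" using False assms(4,5) by (intro \<sigma>) auto
      moreover have "\<pi> y \<noteq> z" using sub assms(4) orbit.base by fast
      ultimately show ?thesis by (metis orbit.base)
    qed
  next
    case (step w)
    consider "w = x" | "w = z" | "w \<noteq> x" "w \<noteq> z" by blast
    then show ?case
    proof cases
      case 1
      then show ?thesis using step \<sigma>x assms(3,4) by auto
    next
      case 2
      then have "\<pi> x \<in> orbit \<pi> y" using step by (auto intro: orbit.step)
      then show ?thesis using 2 \<sigma>z sub assms(4) by auto
    next
      case 3
      then have "\<pi> w \<in> orbit \<pi> y" using step by (auto intro: orbit.step)
      then show ?thesis using \<sigma>[OF 3] sub assms(4) by auto
    qed
  qed
  moreover have "w \<in> orbit ?\<sigma> y" if "w \<in> orbit \<pi> y" for w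
    using that
  proof induction
    case base
    show ?case
    proof (cases "y = x")
      case True
      then have "\<pi> y = ?\<sigma> (?\<sigma> y)" using \<sigma>x \<sigma>z by simp
      then show ?thesis by (metis orbit.base orbit.step)
    next
      case False
      then have "\<pi> y = ?\<sigma> y" using assms(4,5) \<sigma> by metis
      then show ?thesis by (metis orbit.base)
    qed
  next
    case (step w)
    show ?case
    proof (cases "w = x")
      case True
      then have "\<pi> w = ?\<sigma> (?\<sigma> w)" using \<sigma>x \<sigma>z by simp
      then show ?thesis using step.IH by (metis orbit.step)
    next
      case False
      then have "\<pi> w = ?\<sigma> w" using step.hyps sub assms(4) \<sigma> by (metis subsetD)
      then show ?thesis using step.IH by (metis orbit.step)
    qed
  qed
  ultimately show ?thesis using sub assms(4) by blast
qed

lemma num_cycles_contract: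
  assumes "\<pi> permutes S" "finite S" "x \<in> S" "z \<notin> S"
  shows "num_cycles (insert z S) (\<pi> \<circ> Transposition.transpose x z) = num_cycles S \<pi>"
proof -
  let ?\<sigma> = "\<pi> \<circ> Transposition.transpose x z"
  have "?\<sigma> permutes insert z S"
    using assms by (intro permutes_compose permutes_swap_id)
      (auto intro: permutes_subset[OF assms(1)])
  then have perm: "permutation ?\<sigma>" using assms(2) permutation_permutes by blast
  have same: "v \<in> orbit ?\<sigma> w \<longleftrightarrow> orbit ?\<sigma> v = orbit ?\<sigma> w" for v w
    using orbit_cyclic_eq3[OF cyclic_on_orbit'[OF perm]] permutation_self_in_orbit[OF perm] by blast
  have "?\<sigma> x = z" using assms(1,4) permutes_not_in[of \<pi> S z] by simp
  then have "z \<in> orbit ?\<sigma> x" by (metis orbit.base)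
  then have "orbit ?\<sigma> z = orbit ?\<sigma> x" using same by blast
  then have img: "orbit ?\<sigma> ` insert z S = orbit ?\<sigma> ` S" using assms(3) by auto
  have "inj_on (\<lambda>O'. O' - {z}) (orbit ?\<sigma> ` S)"
  proof (rule inj_onI, clarify)
    fix y y' assume y: "y \<in> S" "y' \<in> S" and eq: "orbit ?\<sigma> y - {z} = orbit ?\<sigma> y' - {z}"
    have "y \<in> orbit ?\<sigma> y" using perm by (rule permutation_self_in_orbit)
    then have "y \<in> orbit ?\<sigma> y'" using eq y assms(4) by blast
    then show "orbit ?\<sigma> y = orbit ?\<sigma> y'" using same by blast
  qed
  then have "card (orbit ?\<sigma> ` S) = card ((\<lambda>O'. O' - {z}) ` orbit ?\<sigma> ` S)"
    by (simp add: card_image)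
  also have "(\<lambda>O'. O' - {z}) ` orbit ?\<sigma> ` S = orbit \<pi> ` S"
    unfolding image_image using orbit_contract[OF assms] by (intro image_cong) auto
  finally show ?thesis unfolding num_cycles_def img .
qed

lemma num_cycles_insert_fixpoint:
  assumes "\<pi> permutes S" "finite S" "z \<notin> S"
  shows "num_cycles (insert z S) \<pi> = Suc (num_cycles S \<pi>)"
proof -
  have "orbit \<pi> z = {z}" using assms permutes_not_in[of \<pi> S z] by (simp add: orbit_eq_singleton_iff)
  moreover have "{z} \<notin> orbit \<pi> ` S"
    using assms permutes_orbit_subset[OF assms(1)] by fastforce
  ultimately show ?thesis using assms(2) by (simp add: num_cycles_def)
qed


section \<open>Permanents with partially forbidden fixed points\<close>

text \<open>
  Fixed points are permitted on \<open>X\<close> and forbidden on \<open>Y\<close>. This interpolates between \<open>ext_perm\<close> (\<open>Y\<close> empty) and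
  \<open>ext_dperm\<close> (\<open>X\<close> empty). The mixture is needed because bypassing copies can turn a cycle through a
  primed index into a fixed point, whereas no copy ever becomes fixed.
\<close>

definition partial_dperm :: "'a :: comm_ring_1 \<Rightarrow> 'x set \<Rightarrow> 'x set \<Rightarrow> ('x \<Rightarrow> 'x \<Rightarrow> 'a) \<Rightarrow> 'a" where
  "partial_dperm \<beta> X Y M =
     (\<Sum>\<pi> | \<pi> permutes (X \<union> Y) \<and> (\<forall>y\<in>Y. \<pi> y \<noteq> y).
        \<beta> ^ num_cycles (X \<union> Y) \<pi> * (\<Prod>x\<in>X \<union> Y. M x (\<pi> x)))"

lemma finite_perms: "finite S \<Longrightarrow> finite {\<pi>. \<pi> permutes S \<and> P \<pi>}"
  by (rule finite_subset[OF _ finite_permutations]) auto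

lemma partial_dperm_empty_right: "partial_dperm \<beta> X {} M = ext_perm \<beta> X M"
  by (simp add: partial_dperm_def ext_perm_def)

lemma partial_dperm_cong:
  assumes "\<And>x z. x \<in> X \<union> Y \<Longrightarrow> z \<in> X \<union> Y \<Longrightarrow> M x z = M' x z"
  shows "partial_dperm \<beta> X Y M = partial_dperm \<beta> X Y M'"
  unfolding partial_dperm_def
proof (rule sum.cong[OF refl])
  fix \<pi> assume \<pi>: "\<pi> \<in> {\<pi>. \<pi> permutes (X \<union> Y) \<and> (\<forall>y\<in>Y. \<pi> y \<noteq> y)}"
  then have p: "\<pi> permutes (X \<union> Y)" by simp
  have "(\<Prod>x\<in>X \<union> Y. M x (\<pi> x)) = (\<Prod>x\<in>X \<union> Y. M' x (\<pi> x))"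
    by (rule prod.cong[OF refl], rule assms) (use permutes_in_image[OF p] in blast)+
  then show "\<beta> ^ num_cycles (X \<union> Y) \<pi> * (\<Prod>x\<in>X \<union> Y. M x (\<pi> x)) =
    \<beta> ^ num_cycles (X \<union> Y) \<pi> * (\<Prod>x\<in>X \<union> Y. M' x (\<pi> x))" by simp
qed

text \<open>Moving \<open>X'\<close> from the forbidden to the permitted positions only adds terms that contain a
  diagonal entry from \<open>X'\<close>.\<close>

lemma partial_dperm_zero_diag:
  assumes "finite X" "finite X'" "finite Y" "X \<inter> X' = {}" "X' \<inter> Y = {}"
    and "\<And>x. x \<in> X' \<Longrightarrow> M' x x = 0"
    and "\<And>x z. x \<in> X \<union> X' \<union> Y \<Longrightarrow> z \<in> X \<union> X' \<union> Y \<Longrightarrow> x \<notin> X' \<or> z \<noteq> x \<Longrightarrow> M' x z = M x z"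
  shows "partial_dperm \<beta> X (X' \<union> Y) M = partial_dperm \<beta> (X \<union> X') Y M'"
proof -
  let ?S = "X \<union> X' \<union> Y"
  have S: "X \<union> (X' \<union> Y) = ?S" by auto
  have "partial_dperm \<beta> X (X' \<union> Y) M =
    (\<Sum>\<pi> | \<pi> permutes ?S \<and> (\<forall>y\<in>X' \<union> Y. \<pi> y \<noteq> y). \<beta> ^ num_cycles ?S \<pi> * (\<Prod>x\<in>?S. M' x (\<pi> x)))"
    unfolding partial_dperm_def S
  proof (rule sum.cong[OF refl])
    fix \<pi> assume \<pi>: "\<pi> \<in> {\<pi>. \<pi> permutes ?S \<and> (\<forall>y\<in>X' \<union> Y. \<pi> y \<noteq> y)}"
    then have p: "\<pi> permutes ?S" by simp
    have "(\<Prod>x\<in>?S. M x (\<pi> x)) = (\<Prod>x\<in>?S. M' x (\<pi> x))"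
      by (rule prod.cong[OF refl], rule assms(7)[symmetric])
        (use permutes_in_image[OF p] \<pi> in \<open>blast+\<close>)
    then show "\<beta> ^ num_cycles ?S \<pi> * (\<Prod>x\<in>?S. M x (\<pi> x)) =
      \<beta> ^ num_cycles ?S \<pi> * (\<Prod>x\<in>?S. M' x (\<pi> x))" by simp
  qed
  also have "\<dots> = partial_dperm \<beta> (X \<union> X') Y M'"
    unfolding partial_dperm_def
  proof (rule sum.mono_neutral_left)
    show "\<forall>\<pi>\<in>{\<pi>. \<pi> permutes ?S \<and> (\<forall>y\<in>Y. \<pi> y \<noteq> y)} -
        {\<pi>. \<pi> permutes ?S \<and> (\<forall>y\<in>X' \<union> Y. \<pi> y \<noteq> y)}.
        \<beta> ^ num_cycles ?S \<pi> * (\<Prod>x\<in>?S. M' x (\<pi> x)) = 0"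
    proof
      fix \<pi> assume "\<pi> \<in> {\<pi>. \<pi> permutes ?S \<and> (\<forall>y\<in>Y. \<pi> y \<noteq> y)} -
        {\<pi>. \<pi> permutes ?S \<and> (\<forall>y\<in>X' \<union> Y. \<pi> y \<noteq> y)}"
      then obtain x where "x \<in> X'" "\<pi> x = x" by auto
      then have "(\<Prod>x\<in>?S. M' x (\<pi> x)) = 0"
        using assms(1-3,6) by (intro prod_zero) (auto intro!: bexI[of _ x])
      then show "\<beta> ^ num_cycles ?S \<pi> * (\<Prod>x\<in>?S. M' x (\<pi> x)) = 0" by simp
    qed
  qed (use assms(1-3) in \<open>auto intro: finite_perms\<close>)
  finally show ?thesis .
qed

text \<open>
  The row of \<open>x\<close> enters each term exactly once, so everything is linear in it.
\<close>

lemma partial_dperm_row_split: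
  assumes "finite X" "finite Y" "x \<in> X"
  shows "partial_dperm \<beta> X Y (M(x := \<rho>)) =
     (\<Sum>\<pi> | \<pi> permutes (X \<union> Y) \<and> (\<forall>y\<in>Y. \<pi> y \<noteq> y).
        \<beta> ^ num_cycles (X \<union> Y) \<pi> * (\<Prod>y\<in>X \<union> Y - {x}. M y (\<pi> y)) * \<rho> (\<pi> x))"
  unfolding partial_dperm_def
proof (rule sum.cong[OF refl])
  fix \<pi> :: "'a \<Rightarrow> 'a"
  have "(\<Prod>y\<in>X \<union> Y. (M(x := \<rho>)) y (\<pi> y)) =
     (M(x := \<rho>)) x (\<pi> x) * (\<Prod>y\<in>X \<union> Y - {x}. (M(x := \<rho>)) y (\<pi> y))"
    using assms by (intro prod.remove) auto
  also have "(\<Prod>y\<in>X \<union> Y - {x}. (M(x := \<rho>)) y (\<pi> y)) = (\<Prod>y\<in>X \<union> Y - {x}. M y (\<pi> y))"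
    by (rule prod.cong) auto
  finally show "\<beta> ^ num_cycles (X \<union> Y) \<pi> * (\<Prod>y\<in>X \<union> Y. (M(x := \<rho>)) y (\<pi> y)) =
    \<beta> ^ num_cycles (X \<union> Y) \<pi> * (\<Prod>y\<in>X \<union> Y - {x}. M y (\<pi> y)) * \<rho> (\<pi> x)"
    by (simp add: ac_simps)
qed

lemma partial_dperm_row_add:
  assumes "finite X" "finite Y" "x \<in> X"
  shows "partial_dperm \<beta> X Y (M(x := \<lambda>z. \<rho> z + \<rho>' z)) =
    partial_dperm \<beta> X Y (M(x := \<rho>)) + partial_dperm \<beta> X Y (M(x := \<rho>'))"
  by (simp add: partial_dperm_row_split[OF assms] distrib_left sum.distrib)

lemma partial_dperm_row_scale:
  assumes "finite X" "finite Y" "x \<in> X"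
  shows "partial_dperm \<beta> X Y (M(x := \<lambda>z. c * \<rho> z)) = c * partial_dperm \<beta> X Y (M(x := \<rho>))"
  by (simp add: partial_dperm_row_split[OF assms] sum_distrib_left ac_simps)

text \<open>Permutations with \<open>x \<mapsto> z\<close> correspond to the permutations of the set without \<open>z\<close>: bypass \<open>z\<close>,
  letting \<open>x\<close> inherit the row of \<open>z\<close>. As \<open>z \<noteq> x\<close>, no cycle disappears and no forbidden fixed point
  arises.\<close>

lemma partial_dperm_contract:
  assumes fin: "finite X" "finite Y" and x: "x \<in> X" "x \<notin> Y" and z: "z \<in> X \<union> Y" "z \<noteq> x"
  shows "(\<Sum>\<pi> | \<pi> permutes (X \<union> Y) \<and> (\<forall>y\<in>Y. \<pi> y \<noteq> y) \<and> \<pi> x = z.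
            \<beta> ^ num_cycles (X \<union> Y) \<pi> * (\<Prod>y\<in>X \<union> Y. M y (\<pi> y))) =
         M x z * partial_dperm \<beta> (X - {z}) (Y - {z}) (M(x := M z))"
proof -
  let ?S = "X \<union> Y" and ?t = "Transposition.transpose x z"
  let ?S' = "X - {z} \<union> (Y - {z})"
  have S': "?S' = ?S - {z}" "finite ?S'" "x \<in> ?S'" "z \<notin> ?S'" "insert z ?S' = ?S"
    using fin x z by auto
  have tt: "?t \<circ> ?t = id" by simp
  have tperm: "?t permutes ?S" using x z by (intro permutes_swap_id) auto
  show ?thesis
    unfolding partial_dperm_def sum_distrib_left
  proof (rule sum.reindex_bij_witness[where i = "\<lambda>\<pi>. \<pi> \<circ> ?t" and j = "\<lambda>\<pi>. \<pi> \<circ> ?t"])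
    fix \<pi> assume "\<pi> \<in> {\<pi>. \<pi> permutes ?S \<and> (\<forall>y\<in>Y. \<pi> y \<noteq> y) \<and> \<pi> x = z}"
    then have \<pi>: "\<pi> permutes ?S" "\<And>y. y \<in> Y \<Longrightarrow> \<pi> y \<noteq> y" "\<pi> x = z" by auto
    let ?\<sigma> = "\<pi> \<circ> ?t"
    show eq: "?\<sigma> \<circ> ?t = \<pi>" by (simp add: o_assoc[symmetric] tt)
    have "?\<sigma> permutes ?S" using tperm \<pi>(1) by (rule permutes_compose)
    moreover have "?\<sigma> z = z" using \<pi>(3) by simp
    ultimately have \<sigma>: "?\<sigma> permutes ?S'"
      unfolding S'(1) by (auto intro: permutes_superset)
    have "?\<sigma> y \<noteq> y" if "y \<in> Y - {z}" for y
    proof -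
      have "y \<noteq> x" "y \<noteq> z" using that x(2) by auto
      then show ?thesis using that \<pi>(2)[of y] by (simp add: transpose_apply_other)
    qed
    then show "?\<sigma> \<in> {\<pi>. \<pi> permutes ?S' \<and> (\<forall>y\<in>Y - {z}. \<pi> y \<noteq> y)}" using \<sigma> by blast
    have cyc: "num_cycles ?S \<pi> = num_cycles ?S' ?\<sigma>"
      using num_cycles_contract[OF \<sigma> S'(2,3,4)] unfolding eq S'(5) .
    have "(\<Prod>y\<in>?S. M y (\<pi> y)) = M z (\<pi> z) * (M x z * (\<Prod>y\<in>?S - {z} - {x}. M y (\<pi> y)))"
      using fin x z \<pi>(3) prod.remove[of ?S z "\<lambda>y. M y (\<pi> y)"]
        prod.remove[of "?S - {z}" x "\<lambda>y. M y (\<pi> y)"] by simp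
    also have "(\<Prod>y\<in>?S - {z} - {x}. M y (\<pi> y)) = (\<Prod>y\<in>?S - {z} - {x}. (M(x := M z)) y (?\<sigma> y))"
      by (rule prod.cong) (auto simp: transpose_apply_other)
    also have "M z (\<pi> z) * (M x z * \<dots>) = M x z * ((M(x := M z)) x (?\<sigma> x) * \<dots>)" by (simp add: ac_simps)
    also have "(M(x := M z)) x (?\<sigma> x) * (\<Prod>y\<in>?S - {z} - {x}. (M(x := M z)) y (?\<sigma> y)) =
        (\<Prod>y\<in>?S - {z}. (M(x := M z)) y (?\<sigma> y))"
      using fin x z by (intro prod.remove[symmetric]) auto
    finally show "M x z * (\<beta> ^ num_cycles ?S' ?\<sigma> * (\<Prod>y\<in>?S'. (M(x := M z)) y (?\<sigma> y))) =
      \<beta> ^ num_cycles ?S \<pi> * (\<Prod>y\<in>?S. M y (\<pi> y))"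
      unfolding cyc S'(1) by (simp add: ac_simps)
  next
    fix \<pi> assume "\<pi> \<in> {\<pi>. \<pi> permutes ?S' \<and> (\<forall>y\<in>Y - {z}. \<pi> y \<noteq> y)}"
    then have \<pi>: "\<pi> permutes ?S'" "\<And>y. y \<in> Y \<Longrightarrow> y \<noteq> z \<Longrightarrow> \<pi> y \<noteq> y" by auto
    let ?\<sigma> = "\<pi> \<circ> ?t"
    show "?\<sigma> \<circ> ?t = \<pi>" by (simp add: o_assoc[symmetric] tt)
    have \<pi>z: "\<pi> z = z" using \<pi>(1) S'(4) permutes_not_in by metis
    have "\<pi> permutes ?S" using \<pi>(1) by (rule permutes_subset) auto
    then have "?\<sigma> permutes ?S" using tperm by (intro permutes_compose)
    moreover have "?\<sigma> y \<noteq> y" if y: "y \<in> Y" for y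
    proof (cases "y = z")
      case True
      have "\<pi> x \<in> ?S'" using \<pi>(1) S'(3) permutes_in_image by metis
      then show ?thesis using True S'(4) by auto
    next
      case False
      moreover have "y \<noteq> x" using y x(2) by auto
      ultimately show ?thesis using y \<pi>(2)[of y] by (simp add: transpose_apply_other)
    qed
    ultimately show "?\<sigma> \<in> {\<pi>. \<pi> permutes ?S \<and> (\<forall>y\<in>Y. \<pi> y \<noteq> y) \<and> \<pi> x = z}"
      using \<pi>z by auto
  qed
qed

lemma partial_dperm_fixpoint:
  assumes fin: "finite X" "finite Y" and x: "x \<in> X" "x \<notin> Y"
  shows "(\<Sum>\<pi> | \<pi> permutes (X \<union> Y) \<and> (\<forall>y\<in>Y. \<pi> y \<noteq> y) \<and> \<pi> x = x.
            \<beta> ^ num_cycles (X \<union> Y) \<pi> * (\<Prod>y\<in>X \<union> Y. M y (\<pi> y))) =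
         \<beta> * M x x * partial_dperm \<beta> (X - {x}) Y M"
proof -
  let ?S = "X \<union> Y" and ?S' = "X - {x} \<union> Y"
  have S': "?S' = ?S - {x}" "finite ?S'" "x \<notin> ?S'" "insert x ?S' = ?S"
    using fin x by auto
  show ?thesis
    unfolding partial_dperm_def sum_distrib_left
  proof (rule sum.cong)
    show "{\<pi>. \<pi> permutes ?S \<and> (\<forall>y\<in>Y. \<pi> y \<noteq> y) \<and> \<pi> x = x} =
      {\<pi>. \<pi> permutes ?S' \<and> (\<forall>y\<in>Y. \<pi> y \<noteq> y)}"
    proof -
      have "\<pi> permutes ?S \<and> \<pi> x = x \<longleftrightarrow> \<pi> permutes ?S'" for \<pi>
      proof
        assume "\<pi> permutes ?S \<and> \<pi> x = x"
        then show "\<pi> permutes ?S'" unfolding S'(1) by (auto intro: permutes_superset)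
      next
        assume p: "\<pi> permutes ?S'"
        then have "\<pi> permutes ?S" by (rule permutes_subset) auto
        moreover have "\<pi> x = x" using p S'(3) permutes_not_in by metis
        ultimately show "\<pi> permutes ?S \<and> \<pi> x = x" by simp
      qed
      then show ?thesis by blast
    qed
    fix \<pi> assume "\<pi> \<in> {\<pi>. \<pi> permutes ?S' \<and> (\<forall>y\<in>Y. \<pi> y \<noteq> y)}"
    then have \<pi>: "\<pi> permutes ?S'" by simp
    have "\<pi> x = x" using \<pi> S'(3) permutes_not_in by metis
    then have "(\<Prod>y\<in>?S. M y (\<pi> y)) = M x x * (\<Prod>y\<in>?S'. M y (\<pi> y))"
      using fin x prod.remove[of ?S x "\<lambda>y. M y (\<pi> y)"] unfolding S'(1) by simp
    moreover have "num_cycles ?S \<pi> = Suc (num_cycles ?S' \<pi>)"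
      using num_cycles_insert_fixpoint[OF \<pi> S'(2,3)] unfolding S'(4) .
    ultimately show "\<beta> ^ num_cycles ?S \<pi> * (\<Prod>y\<in>?S. M y (\<pi> y)) =
      \<beta> * M x x * (\<beta> ^ num_cycles ?S' \<pi> * (\<Prod>y\<in>?S'. M y (\<pi> y)))"
      by (simp add: ac_simps)
  qed
qed

text \<open>
  Sorting the permutations by the image of \<open>x\<close> gives a recursion on the number of indices. Block
  triangular matrices and the renaming of indices can then be treated by induction, without further
  bijections between permutations.
\<close>

lemma partial_dperm_expand_row:
  assumes fin: "finite X" "finite Y" and disj: "X \<inter> Y = {}" and xX: "x \<in> X"
  shows "partial_dperm \<beta> X Y M =
    \<beta> * M x x * partial_dperm \<beta> (X - {x}) Y M +
    (\<Sum>z\<in>X - {x}. M x z * partial_dperm \<beta> (X - {z}) Y (M(x := M z))) +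
    (\<Sum>z\<in>Y. M x z * partial_dperm \<beta> X (Y - {z}) (M(x := M z)))"
proof -
  have x: "x \<in> X" "x \<notin> Y" using xX disj by auto
  let ?S = "X \<union> Y"
  let ?P = "{\<pi>. \<pi> permutes ?S \<and> (\<forall>y\<in>Y. \<pi> y \<noteq> y)}"
  let ?w = "\<lambda>\<pi>. \<beta> ^ num_cycles ?S \<pi> * (\<Prod>y\<in>?S. M y (\<pi> y))"
  let ?F = "\<lambda>z. \<Sum>\<pi> | \<pi> permutes ?S \<and> (\<forall>y\<in>Y. \<pi> y \<noteq> y) \<and> \<pi> x = z. ?w \<pi>"
  have "sum ?w ?P = (\<Sum>z\<in>?S. \<Sum>\<pi> | \<pi> \<in> ?P \<and> \<pi> x = z. ?w \<pi>)"
  proof (rule sum.group[symmetric])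
    show "finite ?P" using fin by (intro finite_perms) auto
    show "(\<lambda>\<pi>. \<pi> x) ` ?P \<subseteq> ?S"
      using x by (auto dest: permutes_in_image)
  qed (use fin in auto)
  also have "\<dots> = sum ?F ?S"
    by (simp add: conj_assoc)
  also have "\<dots> = sum ?F (insert x (X - {x} \<union> Y))"
    using x by (intro sum.cong) auto
  also have "\<dots> = ?F x + sum ?F (X - {x} \<union> Y)"
    using fin x disj by (intro sum.insert) auto
  also have "sum ?F (X - {x} \<union> Y) = sum ?F (X - {x}) + sum ?F Y"
    using fin disj by (intro sum.union_disjoint) auto
  also have "?F x = \<beta> * M x x * partial_dperm \<beta> (X - {x}) Y M"
    using fin x disj by (intro partial_dperm_fixpoint) auto
  also have "sum ?F (X - {x}) = (\<Sum>z\<in>X - {x}. M x z * partial_dperm \<beta> (X - {z}) Y (M(x := M z)))"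
  proof (rule sum.cong[OF refl])
    fix z assume z: "z \<in> X - {x}"
    then have "Y - {z} = Y" using disj by auto
    then show "?F z = M x z * partial_dperm \<beta> (X - {z}) Y (M(x := M z))"
      using partial_dperm_contract[OF fin x, of z \<beta> M] z x disj by auto
  qed
  also have "sum ?F Y = (\<Sum>z\<in>Y. M x z * partial_dperm \<beta> X (Y - {z}) (M(x := M z)))"
  proof (rule sum.cong[OF refl])
    fix z assume z: "z \<in> Y"
    then have "X - {z} = X" using disj by auto
    then show "?F z = M x z * partial_dperm \<beta> X (Y - {z}) (M(x := M z))"
      using partial_dperm_contract[OF fin x, of z \<beta> M] z x disj by auto
  qed
  finally show ?thesis unfolding partial_dperm_def add.assoc .
qed

text \<open>
  If no weight leads from \<open>X\<close> to \<open>Y\<close>, only permutations preserving both sets contribute. Instead of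
  splitting such permutations, the induction expands both sides along the same row of \<open>X\<close>; the factor
  of \<open>Y\<close> is unaffected by it.
\<close>

lemma partial_dperm_block_triangular:
  assumes "finite X" "finite Y" "X \<inter> Y = {}" "\<And>x y. x \<in> X \<Longrightarrow> y \<in> Y \<Longrightarrow> M x y = 0"
  shows "partial_dperm \<beta> X Y M = ext_perm \<beta> X M * partial_dperm \<beta> {} Y M"
  using assms(1,3,4)
proof (induction X arbitrary: M rule: finite_psubset_induct)
  case (psubset X M)
  show ?case
  proof (cases "X = {}")
    case True
    then show ?thesis by (simp add: ext_perm_def num_cycles_def)
  next
    case False
    then obtain x where x: "x \<in> X" by blast
    let ?E = "\<lambda>X M. partial_dperm \<beta> X {} M" and ?T = "partial_dperm \<beta> {} Y M"
    have *: "partial_dperm \<beta> (X - {z}) Y M' = ?E (X - {z}) M' * ?T"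
      if "z \<in> X" "\<And>w y. w \<in> X \<Longrightarrow> y \<in> Y \<Longrightarrow> M' w y = 0" "\<And>y. y \<in> Y \<Longrightarrow> M' y = M y" for z M'
    proof -
      have "partial_dperm \<beta> (X - {z}) Y M' = ?E (X - {z}) M' * partial_dperm \<beta> {} Y M'"
        unfolding partial_dperm_empty_right
        using psubset.prems that by (intro psubset.IH) auto
      also have "partial_dperm \<beta> {} Y M' = ?T"
        by (rule partial_dperm_cong) (use that(3) in auto)
      finally show ?thesis .
    qed
    have "partial_dperm \<beta> X Y M =
        \<beta> * M x x * partial_dperm \<beta> (X - {x}) Y M +
        (\<Sum>z\<in>X - {x}. M x z * partial_dperm \<beta> (X - {z}) Y (M(x := M z)))"
      by (subst partial_dperm_expand_row[OF psubset.hyps assms(2) psubset.prems(1) x])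
        (simp add: sum.neutral psubset.prems(2)[OF x])
    also have "partial_dperm \<beta> (X - {x}) Y M = ?E (X - {x}) M * ?T"
      by (rule *[OF x psubset.prems(2) refl])
    also have "(\<Sum>z\<in>X - {x}. M x z * partial_dperm \<beta> (X - {z}) Y (M(x := M z))) =
        (\<Sum>z\<in>X - {x}. M x z * (?E (X - {z}) (M(x := M z)) * ?T))"
    proof (rule sum.cong[OF refl])
      fix z assume z: "z \<in> X - {x}"
      have "partial_dperm \<beta> (X - {z}) Y (M(x := M z)) = ?E (X - {z}) (M(x := M z)) * ?T"
      proof (rule *)
        show "z \<in> X" using z by simp
        show "(M(x := M z)) w y = 0" if "w \<in> X" "y \<in> Y" for w y
          using z that psubset.prems(2)[of z y] psubset.prems(2)[of w y] by (cases "w = x") simp_all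
        show "(M(x := M z)) y = M y" if "y \<in> Y" for y
          using that x psubset.prems(1) by (cases "y = x") auto
      qed
      then show "M x z * partial_dperm \<beta> (X - {z}) Y (M(x := M z)) =
        M x z * (?E (X - {z}) (M(x := M z)) * ?T)" by simp
    qed
    also have "\<beta> * M x x * (?E (X - {x}) M * ?T) + \<dots> =
        (\<beta> * M x x * ?E (X - {x}) M + (\<Sum>z\<in>X - {x}. M x z * ?E (X - {z}) (M(x := M z)))) * ?T"
      by (simp add: algebra_simps sum_distrib_left)
    also have "\<dots> = ?E X M * ?T"
      using partial_dperm_expand_row[of X "{}" x \<beta> M] psubset.hyps x by simp
    finally show ?thesis unfolding partial_dperm_empty_right .
  qed
qed

lemma ext_perm_expand_row:
  assumes "finite X" "x \<in> X"
  shows "ext_perm \<beta> X M = \<beta> * M x x * ext_perm \<beta> (X - {x}) M +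
    (\<Sum>z\<in>X - {x}. M x z * ext_perm \<beta> (X - {z}) (M(x := M z)))"
  using partial_dperm_expand_row[of X "{}" x \<beta> M] assms by (simp add: partial_dperm_empty_right)

lemma ext_perm_relabel:
  assumes "finite X" "inj_on h X" "\<And>x z. x \<in> X \<Longrightarrow> z \<in> X \<Longrightarrow> M' (h x) (h z) = M x z"
  shows "ext_perm \<beta> (h ` X) M' = ext_perm \<beta> X M"
  using assms
proof (induction X arbitrary: M M' rule: finite_psubset_induct)
  case (psubset X M M')
  note inj = psubset.prems(1) and eq = psubset.prems(2)
  show ?case
  proof (cases "X = {}")
    case True
    then show ?thesis by (simp add: ext_perm_def num_cycles_def)
  next
    case False
    then obtain x where x: "x \<in> X" by blast
    have IH: "ext_perm \<beta> (h ` X - {h z}) N' = ext_perm \<beta> (X - {z}) N"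
      if z: "z \<in> X" and N: "\<And>w y. w \<in> X \<Longrightarrow> y \<in> X \<Longrightarrow> N' (h w) (h y) = N w y" for z N N'
    proof -
      have "h ` X - {h z} = h ` (X - {z})"
        using inj z by (simp add: inj_on_image_set_diff[of h X])
      moreover have "ext_perm \<beta> (h ` (X - {z})) N' = ext_perm \<beta> (X - {z}) N"
        using z inj by (intro psubset.IH N) (auto intro: inj_on_subset)
      ultimately show ?thesis by simp
    qed
    have "(\<Sum>z\<in>h ` X - {h x}. M' (h x) z * ext_perm \<beta> (h ` X - {z}) (M'(h x := M' z))) =
        (\<Sum>z\<in>h ` (X - {x}). M' (h x) z * ext_perm \<beta> (h ` X - {z}) (M'(h x := M' z)))"
      using inj x by (simp add: inj_on_image_set_diff[of h X])
    also have "\<dots> = (\<Sum>z\<in>X - {x}. M' (h x) (h z) * ext_perm \<beta> (h ` X - {h z}) (M'(h x := M' (h z))))"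
      by (subst sum.reindex) (auto intro: inj_on_subset[OF inj])
    also have "\<dots> = (\<Sum>z\<in>X - {x}. M x z * ext_perm \<beta> (X - {z}) (M(x := M z)))"
    proof (rule sum.cong[OF refl])
      fix z assume z: "z \<in> X - {x}"
      have "ext_perm \<beta> (h ` X - {h z}) (M'(h x := M' (h z))) = ext_perm \<beta> (X - {z}) (M(x := M z))"
      proof (rule IH)
        fix w y assume "w \<in> X" "y \<in> X"
        then show "(M'(h x := M' (h z))) (h w) (h y) = (M(x := M z)) w y"
          using z x eq[of z y] eq[of w y] inj by (auto simp: inj_on_eq_iff)
      qed (use z in auto)
      then show "M' (h x) (h z) * ext_perm \<beta> (h ` X - {h z}) (M'(h x := M' (h z))) =
          M x z * ext_perm \<beta> (X - {z}) (M(x := M z))"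
        using eq x z by simp
    qed
    finally have "(\<Sum>z\<in>h ` X - {h x}. M' (h x) z * ext_perm \<beta> (h ` X - {z}) (M'(h x := M' z))) =
      (\<Sum>z\<in>X - {x}. M x z * ext_perm \<beta> (X - {z}) (M(x := M z)))" .
    moreover have "ext_perm \<beta> (h ` X - {h x}) M' = ext_perm \<beta> (X - {x}) M"
      using x eq by (rule IH)
    ultimately show ?thesis
      using psubset.hyps x eq[OF x x]
      by (simp add: ext_perm_expand_row[of "h ` X" "h x" \<beta> M'] ext_perm_expand_row[of X x \<beta> M])
  qed
qed

text \<open>
  Forbidding a fixed point has the same effect as setting its diagonal entry to zero; hence invariance
  under renaming carries over from \<open>ext_perm\<close>.
\<close>

lemma partial_dperm_eq_ext_perm:
  assumes "finite X" "finite Y" "X \<inter> Y = {}"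
  shows "partial_dperm \<beta> X Y M = ext_perm \<beta> (X \<union> Y) (\<lambda>x z. if x \<in> Y \<and> z = x then 0 else M x z)"
proof -
  have "partial_dperm \<beta> X (Y \<union> {}) M =
      partial_dperm \<beta> (X \<union> Y) {} (\<lambda>x z. if x \<in> Y \<and> z = x then 0 else M x z)"
    by (rule partial_dperm_zero_diag) (use assms in auto)
  then show ?thesis by (simp add: partial_dperm_empty_right)
qed

lemma partial_dperm_relabel:
  assumes "finite X" "finite Y" "X \<inter> Y = {}" "inj_on h (X \<union> Y)"
    and "\<And>x z. x \<in> X \<union> Y \<Longrightarrow> z \<in> X \<union> Y \<Longrightarrow> M' (h x) (h z) = M x z"
  shows "partial_dperm \<beta> (h ` X) (h ` Y) M' = partial_dperm \<beta> X Y M"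
proof -
  have "h ` X \<inter> h ` Y = {}" using assms(3,4) by (auto simp: inj_on_def)
  then have "partial_dperm \<beta> (h ` X) (h ` Y) M' =
      ext_perm \<beta> (h ` (X \<union> Y)) (\<lambda>x z. if x \<in> h ` Y \<and> z = x then 0 else M' x z)"
    using assms(1,2) by (simp add: partial_dperm_eq_ext_perm image_Un)
  also have "\<dots> = ext_perm \<beta> (X \<union> Y) (\<lambda>x z. if x \<in> Y \<and> z = x then 0 else M x z)"
  proof (rule ext_perm_relabel)
    fix x z assume xz: "x \<in> X \<union> Y" "z \<in> X \<union> Y"
    have "h x \<in> h ` Y \<longleftrightarrow> x \<in> Y" using assms(4) xz(1) by (auto simp: inj_on_def)
    moreover have "h z = h x \<longleftrightarrow> z = x" using assms(4) xz by (auto simp: inj_on_def)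
    ultimately show "(if h x \<in> h ` Y \<and> h z = h x then 0 else M' (h x) (h z)) =
        (if x \<in> Y \<and> z = x then 0 else M x z)"
      using assms(5)[OF xz] by simp
  qed (use assms in auto)
  also have "\<dots> = partial_dperm \<beta> X Y M"
    using assms by (simp add: partial_dperm_eq_ext_perm)
  finally show ?thesis .
qed

text \<open>
  The permutations that map \<open>x\<close> into \<open>X\<close> are exactly the ones that survive when the entries of row \<open>x\<close> in
  the columns of \<open>Y\<close> are cleared; the others are contracted.
\<close>

lemma partial_dperm_peel_row:
  assumes fin: "finite X" "finite Y" and disj: "X \<inter> Y = {}" and x: "x \<in> X"
    and \<rho>: "\<And>z. z \<in> X \<Longrightarrow> \<rho> z = M x z" "\<And>z. z \<in> Y \<Longrightarrow> \<rho> z = 0"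
  shows "partial_dperm \<beta> X Y M =
    partial_dperm \<beta> X Y (M(x := \<rho>)) + (\<Sum>z\<in>Y. M x z * partial_dperm \<beta> X (Y - {z}) (M(x := M z)))"
proof -
  have "partial_dperm \<beta> X Y (M(x := \<rho>)) =
    \<beta> * \<rho> x * partial_dperm \<beta> (X - {x}) Y (M(x := \<rho>)) +
    (\<Sum>z\<in>X - {x}. \<rho> z * partial_dperm \<beta> (X - {z}) Y (M(x := M z)))"
    by (subst partial_dperm_expand_row[OF fin disj x]) (simp add: \<rho>(2))
  also have "partial_dperm \<beta> (X - {x}) Y (M(x := \<rho>)) = partial_dperm \<beta> (X - {x}) Y M"
    using disj x by (intro partial_dperm_cong) auto
  also have "(\<Sum>z\<in>X - {x}. \<rho> z * partial_dperm \<beta> (X - {z}) Y (M(x := M z))) =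
      (\<Sum>z\<in>X - {x}. M x z * partial_dperm \<beta> (X - {z}) Y (M(x := M z)))"
    using \<rho>(1) by (intro sum.cong) auto
  finally have "partial_dperm \<beta> X Y (M(x := \<rho>)) =
    \<beta> * M x x * partial_dperm \<beta> (X - {x}) Y M +
    (\<Sum>z\<in>X - {x}. M x z * partial_dperm \<beta> (X - {z}) Y (M(x := M z)))"
    by (simp only: \<rho>(1)[OF x])
  then show ?thesis
    using partial_dperm_expand_row[OF fin disj x, of \<beta> M] by (simp only:)
qed


section \<open>Summation of formal power series\<close>

text \<open>
  Addition and multiplication are continuous because each coefficient of the result depends on finitely
  many coefficients of the arguments. This makes the general rules for infinite sums available.
\<close>

instance mfps :: (type, comm_ring_1) topological_comm_monoid_add
proof
  fix a b :: "('a, 'b) mfps"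
  show "((\<lambda>x. fst x + snd x) \<longlongrightarrow> a + b) (nhds a \<times>\<^sub>F nhds b)"
    unfolding tendsto_mfps_iff
  proof
    fix m
    have "\<forall>\<^sub>F x in nhds a \<times>\<^sub>F nhds b. mfps_nth (fst x) m = mfps_nth a m"
      using filterlim_fst[of "nhds a" "nhds b"] unfolding tendsto_mfps_iff by blast
    moreover have "\<forall>\<^sub>F x in nhds a \<times>\<^sub>F nhds b. mfps_nth (snd x) m = mfps_nth b m"
      using filterlim_snd[of "nhds b" "nhds a"] unfolding tendsto_mfps_iff by blast
    ultimately show "\<forall>\<^sub>F x in nhds a \<times>\<^sub>F nhds b. mfps_nth (fst x + snd x) m = mfps_nth (a + b) m"
      by eventually_elim (simp add: plus_mfps.rep_eq)
  qed
qed

instance mfps :: (type, comm_ring_1) topological_semigroup_mult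
proof
  fix a b :: "('a, 'b) mfps"
  show "((\<lambda>x. fst x * snd x) \<longlongrightarrow> a * b) (nhds a \<times>\<^sub>F nhds b)"
    unfolding tendsto_mfps_iff
  proof
    fix m :: "'a multiset"
    have "\<forall>\<^sub>F x in nhds a \<times>\<^sub>F nhds b. \<forall>c\<in>{c. c \<subseteq># m}. mfps_nth (fst x) c = mfps_nth a c"
      using filterlim_fst[of "nhds a" "nhds b"] unfolding tendsto_mfps_iff
      by (intro eventually_ball_finite finite_mset_subsets) blast
    moreover have "\<forall>\<^sub>F x in nhds a \<times>\<^sub>F nhds b. \<forall>c\<in>{c. c \<subseteq># m}. mfps_nth (snd x) c = mfps_nth b c"
      using filterlim_snd[of "nhds b" "nhds a"] unfolding tendsto_mfps_iff
      by (intro eventually_ball_finite finite_mset_subsets) blast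
    ultimately show "\<forall>\<^sub>F x in nhds a \<times>\<^sub>F nhds b. mfps_nth (fst x * snd x) m = mfps_nth (a * b) m"
      by eventually_elim (auto simp: times_mfps.rep_eq intro!: sum.cong)
  qed
qed

lemma has_sum_sum:
  fixes f :: "'j \<Rightarrow> 'i \<Rightarrow> 'b :: topological_comm_monoid_add"
  assumes "finite J" "\<And>j. j \<in> J \<Longrightarrow> (f j has_sum s j) A"
  shows "((\<lambda>i. \<Sum>j\<in>J. f j i) has_sum (\<Sum>j\<in>J. s j)) A"
  using assms by (induction J) (auto intro: has_sum_add)

lemma mfps_order_ge_mono: "mfps_order_ge d f \<Longrightarrow> e \<le> d \<Longrightarrow> mfps_order_ge e f"
  by (auto simp: mfps_order_ge_def)

lemma mfps_order_ge_prod: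
  fixes f :: "'i \<Rightarrow> ('v, 'a :: comm_ring_1) mfps"
  assumes "\<And>x. x \<in> X \<Longrightarrow> mfps_order_ge (d x) (f x)"
  shows "mfps_order_ge (\<Sum>x\<in>X. d x) (prod f X)"
  using assms by (induction X rule: infinite_finite_induct) (auto intro: mfps_order_ge_mult)

lemma mfps_const_mult: "mfps_const (a * b) = mfps_const a * (mfps_const b :: ('v, 'a :: comm_ring_1) mfps)"
proof (rule mfps_eqI)
  fix m :: "'v multiset"
  have "mfps_nth (mfps_const a * mfps_const b) m =
      (\<Sum>p\<in>{(c, d). c + d = m}. if p = ({#}, {#}) then a * b else 0)"
    unfolding times_mfps.rep_eq mfps_const.rep_eq by (rule sum.cong) (auto split: if_splits)
  also have "\<dots> = (if m = {#} then a * b else 0)"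
    by (subst sum.delta) (auto simp: finite_mset_decomps)
  finally show "mfps_nth (mfps_const (a * b)) m = mfps_nth (mfps_const a * mfps_const b) m"
    by (simp add: mfps_const.rep_eq)
qed

lemma mfps_const_0 [simp]: "mfps_const 0 = 0" and mfps_const_1 [simp]: "mfps_const 1 = 1"
  by (auto intro!: mfps_eqI simp: mfps_const.rep_eq zero_mfps.rep_eq one_mfps.rep_eq)

lemma mfps_const_add: "mfps_const (a + b) = mfps_const a + (mfps_const b :: ('v, 'a :: comm_ring_1) mfps)"
  by (rule mfps_eqI) (simp add: mfps_const.rep_eq plus_mfps.rep_eq)

lemma mfps_const_of_nat: "mfps_const (of_nat n) = (of_nat n :: ('v, 'a :: comm_ring_1) mfps)"
  by (induction n) (simp_all add: mfps_const_add)

lemma finite_bounded_sum: "finite {r :: 'n :: finite \<Rightarrow> nat. (\<Sum>i\<in>UNIV. r i) \<le> d}"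
proof (rule finite_subset)
  show "{r :: 'n \<Rightarrow> nat. (\<Sum>i\<in>UNIV. r i) \<le> d} \<subseteq> (UNIV \<rightarrow>\<^sub>E {..d})"
  proof
    fix r :: "'n \<Rightarrow> nat" assume r: "r \<in> {r. (\<Sum>i\<in>UNIV. r i) \<le> d}"
    have "r i \<le> (\<Sum>i\<in>UNIV. r i)" for i by (rule member_le_sum) auto
    then show "r \<in> UNIV \<rightarrow>\<^sub>E {..d}" using r by (auto intro: order_trans)
  qed
qed (simp add: finite_PiE)

text \<open>
  A monomial of degree \<open>d\<close> can only occur in the terms with \<open>\<Sum>i. r i \<le> d\<close>, and these are finitely many.
\<close>

lemma summable_mfps_multiorder:
  fixes f :: "('n :: finite \<Rightarrow> nat) \<Rightarrow> ('v, 'a :: comm_ring_1) mfps"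
  assumes "\<And>r. mfps_order_ge (\<Sum>i\<in>UNIV. r i) (f r)"
  shows "f summable_on S"
proof -
  have "{r\<in>S. mfps_nth (f r) m \<noteq> 0} \<subseteq> {r. (\<Sum>i\<in>UNIV. r i) \<le> size m}" for m
    using assms unfolding mfps_order_ge_def by (auto simp: not_le[symmetric])
  then have "finite {r\<in>S. mfps_nth (f r) m \<noteq> 0}" for m
    by (rule finite_subset) (rule finite_bounded_sum)
  then have "(f has_sum Abs_mfps (\<lambda>m. \<Sum>r\<in>{r\<in>S. mfps_nth (f r) m \<noteq> 0}. mfps_nth (f r) m)) S"
    unfolding has_sum_mfps_iff by simp
  then show ?thesis by (rule has_sum_imp_summable)
qed


section \<open>Summing over the numbers of coloured copies\<close>

definition copies :: "('n \<Rightarrow> nat) \<Rightarrow> ('m + 'n \<times> nat) set" where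
  "copies r = Inr ` (SIGMA i:UNIV. {1..r i})"

text \<open>
  Rows of the block matrix depend on a copy only through its colour. Taking a row as a pair of
  functions makes it possible to replace the row of a primed index by the row of a colour.
\<close>

definition colour_row :: "('m \<Rightarrow> 'a) \<Rightarrow> ('n \<Rightarrow> 'a) \<Rightarrow> 'm + 'n \<times> nat \<Rightarrow> 'a" where
  "colour_row b u = case_sum b (u \<circ> fst)"

definition colour_matrix ::
    "('m \<Rightarrow> 'm \<Rightarrow> 'a) \<Rightarrow> ('m \<Rightarrow> 'n \<Rightarrow> 'a) \<Rightarrow> ('n \<Rightarrow> 'm \<Rightarrow> 'a) \<Rightarrow> ('n \<Rightarrow> 'n \<Rightarrow> 'a)
      \<Rightarrow> 'm + 'n \<times> nat \<Rightarrow> 'm + 'n \<times> nat \<Rightarrow> 'a" where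
  "colour_matrix b u v a = case_sum (\<lambda>x. colour_row (b x) (u x)) (\<lambda>(i, _). colour_row (v i) (a i))"

lemma colour_row_simps [simp]:
  "colour_row b u (Inl y) = b y" "colour_row b u (Inr (j, k)) = u j"
  by (simp_all add: colour_row_def)

lemma colour_matrix_simps [simp]:
  "colour_matrix b u v a (Inl x) = colour_row (b x) (u x)"
  "colour_matrix b u v a (Inr (i, k)) = colour_row (v i) (a i)"
  by (simp_all add: colour_matrix_def)

lemma colour_matrix_upd_row:
  "(colour_matrix b u v a)(Inl x := colour_row b' u') = colour_matrix (b(x := b')) (u(x := u')) v a"
  by (auto simp: colour_matrix_def fun_eq_iff split: sum.splits)

lemma finite_copies [simp]: "finite (copies (r :: 'n :: finite \<Rightarrow> nat))"
  by (simp add: copies_def)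

lemma copies_disjoint: "Inl ` X \<inter> copies r = {}"
  by (auto simp: copies_def)

lemma card_copies: "card (copies (r :: 'n :: finite \<Rightarrow> nat)) = (\<Sum>i\<in>UNIV. r i)"
  by (simp add: copies_def card_image card_SigmaI)

lemma sum_copies:
  "(\<Sum>z\<in>copies (r :: 'n :: finite \<Rightarrow> nat). f z) = (\<Sum>i\<in>UNIV. \<Sum>k=1..r i. f (Inr (i, k)))"
proof -
  have "(\<Sum>z\<in>copies r. f z) = (\<Sum>p\<in>(SIGMA i:UNIV. {1..r i}). f (Inr p))"
    unfolding copies_def by (subst sum.reindex) auto
  also have "\<dots> = (\<Sum>i\<in>UNIV. \<Sum>k=1..r i. f (Inr (i, k)))"
    by (subst sum.Sigma) (auto simp: case_prod_unfold)
  finally show ?thesis .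
qed

text \<open>
  Removing the copy with the largest label leaves again a full set of copies; this is why a copy to be
  removed is first exchanged with that one, and why that one is marked.
\<close>

lemma copies_decrease: "copies r - {Inr (j, r j)} = copies (r(j := r j - 1))"
  by (fastforce simp: copies_def split: if_splits)

text \<open>Copies of the same colour are interchangeable.\<close>

lemma partial_dperm_remove_copy:
  fixes r :: "'c :: finite \<Rightarrow> nat" and b :: "'b \<Rightarrow> 'b \<Rightarrow> 'a :: comm_ring_1"
  assumes "1 \<le> k" "k \<le> r j" "finite X"
  shows "partial_dperm \<beta> (Inl ` X) (copies r - {Inr (j, k)}) (colour_matrix b u v a) =
    partial_dperm \<beta> (Inl ` X) (copies (r(j := r j - 1))) (colour_matrix b u v a)"
proof -
  let ?h = "Transposition.transpose (Inr (j, k)) (Inr (j, r j)) :: 'b + 'c \<times> nat \<Rightarrow> _"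
  have "?h ` copies r = copies r"
    using assms by (intro permutes_image permutes_swap_id) (auto simp: copies_def)
  then have "?h ` (copies r - {Inr (j, k)}) = copies r - {Inr (j, r j)}"
    by (subst image_set_diff) auto
  moreover have "?h ` Inl ` X = Inl ` X"
    by (auto simp: image_image Transposition.transpose_def)
  moreover have "partial_dperm \<beta> (?h ` Inl ` X) (?h ` (copies r - {Inr (j, k)})) (colour_matrix b u v a) =
      partial_dperm \<beta> (Inl ` X) (copies r - {Inr (j, k)}) (colour_matrix b u v a)"
  proof (rule partial_dperm_relabel)
    show "colour_matrix b u v a (?h y) (?h z) = colour_matrix b u v a y z" for y z
      by (cases y; cases z) (auto simp: Transposition.transpose_def)
  qed (use assms(3) copies_disjoint[of X r] in \<open>auto intro: inj_on_subset[OF _ subset_UNIV]\<close>)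
  ultimately show ?thesis by (simp add: copies_decrease)
qed

text \<open>
  Each \<open>y \<in> Y\<close> is the image of exactly one index, so every product contains \<open>card Y\<close> factors from the columns
  of \<open>Y\<close>. Without constant terms there, the sum over all multiplicities converges.
\<close>

lemma partial_dperm_order_ge:
  fixes M :: "'x \<Rightarrow> 'x \<Rightarrow> ('v, 'a :: comm_ring_1) mfps"
  assumes "finite X" "finite Y" "X \<inter> Y = {}"
    "\<And>x y. x \<in> X \<union> Y \<Longrightarrow> y \<in> Y \<Longrightarrow> mfps_order_ge 1 (M x y)"
  shows "mfps_order_ge (card Y) (partial_dperm \<beta> X Y M)"
  unfolding partial_dperm_def
proof (rule mfps_order_ge_sum)
  fix \<pi> assume "\<pi> \<in> {\<pi>. \<pi> permutes X \<union> Y \<and> (\<forall>y\<in>Y. \<pi> y \<noteq> y)}"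
  then have \<pi>: "\<pi> permutes (X \<union> Y)" by simp
  have "(\<Sum>x\<in>X \<union> Y. if \<pi> x \<in> Y then 1 else 0) = (\<Sum>x\<in>X \<union> Y. if x \<in> Y then 1 else 0 :: nat)"
    using sum.permute[OF \<pi>, of "\<lambda>x. if x \<in> Y then 1 else 0 :: nat"] by (simp add: o_def)
  also have "\<dots> = card Y" using assms(1,2) by (simp add: sum.If_cases Int_absorb1)
  finally have card: "(\<Sum>x\<in>X \<union> Y. if \<pi> x \<in> Y then 1 else 0) = card Y" .
  have "mfps_order_ge (\<Sum>x\<in>X \<union> Y. if \<pi> x \<in> Y then 1 else 0) (\<Prod>x\<in>X \<union> Y. M x (\<pi> x))"
    using assms(4) by (intro mfps_order_ge_prod) auto
  then show "mfps_order_ge (card Y) (\<beta> ^ num_cycles (X \<union> Y) \<pi> * (\<Prod>x\<in>X \<union> Y. M x (\<pi> x)))"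
    unfolding card using mfps_order_ge_mult[of 0] by fastforce
qed

definition multi_fact :: "('n :: finite \<Rightarrow> nat) \<Rightarrow> 'a :: field_char_0" where
  "multi_fact r = (\<Prod>i\<in>UNIV. fact (r i))"

lemma multi_fact_decrease:
  assumes "r j > 0"
  shows "multi_fact r = of_nat (r j) * multi_fact (r(j := r j - 1))"
proof -
  have "(\<Prod>i\<in>UNIV - {j}. fact ((r(j := r j - 1)) i)) = (\<Prod>i\<in>UNIV - {j}. fact (r i) :: 'b)"
    by (rule prod.cong) auto
  moreover have "fact (r j) = of_nat (r j) * (fact (r j - 1) :: 'b)"
    using assms by (rule fact_reduce)
  ultimately show ?thesis
    unfolding multi_fact_def by (simp add: prod.remove[of UNIV j])
qed

text \<open>
  The left-hand side of the identity for a subset \<open>X\<close> of the primed indices and arbitrary weights, with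
  fixed points permitted on \<open>X\<close>.
\<close>

definition copy_sum ::
    "('v, 'a :: field_char_0) mfps \<Rightarrow> 'm set \<Rightarrow> ('m \<Rightarrow> 'm \<Rightarrow> ('v, 'a) mfps) \<Rightarrow> ('m \<Rightarrow> 'n :: finite \<Rightarrow> ('v, 'a) mfps)
      \<Rightarrow> ('n \<Rightarrow> 'm \<Rightarrow> ('v, 'a) mfps) \<Rightarrow> ('n \<Rightarrow> 'n \<Rightarrow> ('v, 'a) mfps) \<Rightarrow> ('v, 'a) mfps" where
  "copy_sum \<beta> X b u v a =
     (\<Sum>\<^sub>\<infinity>r. mfps_const (1 / multi_fact r) * partial_dperm \<beta> (Inl ` X) (copies r) (colour_matrix b u v a))"

lemma has_sum_copy_sum:
  fixes \<beta> :: "('v, 'a :: field_char_0) mfps"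
  assumes "finite X" "\<And>x j. x \<in> X \<Longrightarrow> mfps_order_ge 1 (u x j)" "\<And>i j. mfps_order_ge 1 (a i j)"
  shows "((\<lambda>r. mfps_const (1 / multi_fact r) * partial_dperm \<beta> (Inl ` X) (copies r) (colour_matrix b u v a))
           has_sum copy_sum \<beta> X b u v a) UNIV"
  unfolding copy_sum_def
proof (rule has_sum_infsum, rule summable_mfps_multiorder, rule mfps_order_ge_const_mult)
  fix r
  have "mfps_order_ge (card (copies r :: ('b + 'c \<times> nat) set))
      (partial_dperm \<beta> (Inl ` X) (copies r) (colour_matrix b u v a))"
    using assms by (intro partial_dperm_order_ge) (auto simp: copies_def)
  then show "mfps_order_ge (\<Sum>i\<in>UNIV. r i) (partial_dperm \<beta> (Inl ` X) (copies r) (colour_matrix b u v a))"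
    by (simp only: card_copies)
qed

lemma copy_sum_cong:
  assumes "\<And>x y. x \<in> X \<Longrightarrow> y \<in> X \<Longrightarrow> b x y = b' x y" "\<And>x j. x \<in> X \<Longrightarrow> u x j = u' x j"
    "\<And>i y. y \<in> X \<Longrightarrow> v i y = v' i y"
  shows "copy_sum \<beta> X b u v a = copy_sum \<beta> X b' u' v' a"
  unfolding copy_sum_def
  by (intro infsum_cong arg_cong2[where f = "(*)"] refl partial_dperm_cong)
    (use assms in \<open>auto simp: copies_def\<close>)

text \<open>
  The weight \<open>r j / r!\<close> vanishes for \<open>r j = 0\<close> and otherwise equals the weight of the multiplicities with
  \<open>r j\<close> decreased by one. Choosing one of the copies of colour \<open>j\<close> thus reproduces the whole sum.
\<close>

lemma sum_reindex_decrease: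
  fixes f :: "('n :: finite \<Rightarrow> nat) \<Rightarrow> ('v, 'a :: field_char_0) mfps"
  assumes "((\<lambda>r. mfps_const (1 / multi_fact r) * f r) has_sum s) UNIV"
  shows "((\<lambda>r. mfps_const (of_nat (r j) / multi_fact r) * f (r(j := r j - 1))) has_sum s) UNIV"
proof -
  let ?g = "\<lambda>r. mfps_const (of_nat (r j) / multi_fact r) * f (r(j := r j - 1))"
  let ?h = "\<lambda>r :: 'n \<Rightarrow> nat. r(j := Suc (r j))"
  have inj: "inj ?h"
    by (rule inj_on_inverseI[where g = "\<lambda>r. r(j := r j - 1)"]) simp
  have "?g (?h r) = mfps_const (1 / multi_fact r) * f r" for r
  proof -
    have "multi_fact (?h r) = of_nat (Suc (r j)) * (multi_fact r :: 'a)"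
      using multi_fact_decrease[of "?h r" j] by simp
    then show ?thesis by (simp del: of_nat_Suc)
  qed
  then have "(?g has_sum s) (range ?h)"
    using assms by (simp add: has_sum_reindex[OF inj] o_def)
  moreover have "?g r = 0" if "r \<notin> range ?h" for r
  proof -
    have "r = ?h (r(j := r j - 1))" if "r j > 0" using that by simp
    then have "r j = 0" using that by blast
    then show ?thesis by simp
  qed
  ultimately show ?thesis
    by (subst has_sum_cong_neutral[of "range ?h" UNIV _ ?g]) auto
qed


lemma partial_dperm_peel_copies:
  fixes r :: "'n :: finite \<Rightarrow> nat" and b :: "'m \<Rightarrow> 'm \<Rightarrow> 'a :: comm_ring_1"
  assumes "finite X" "x \<in> X"
  shows "partial_dperm \<beta> (Inl ` X) (copies r) (colour_matrix b u v a) =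
    partial_dperm \<beta> (Inl ` X) (copies r) (colour_matrix b (u(x := \<lambda>j. 0)) v a) +
    (\<Sum>j\<in>UNIV. of_nat (r j) * (u x j * partial_dperm \<beta> (Inl ` X) (copies (r(j := r j - 1)))
        (colour_matrix (b(x := v j)) (u(x := a j)) v a)))"
proof -
  let ?X = "Inl ` X :: ('m + 'n \<times> nat) set" and ?M = "colour_matrix b u v a"
  have "partial_dperm \<beta> ?X (copies r) ?M =
      partial_dperm \<beta> ?X (copies r) (?M(Inl x := colour_row (b x) (\<lambda>j. 0))) +
      (\<Sum>z\<in>copies r. ?M (Inl x) z * partial_dperm \<beta> ?X (copies r - {z}) (?M(Inl x := ?M z)))"
    using assms by (intro partial_dperm_peel_row copies_disjoint) (auto simp: copies_def)
  also have "(\<Sum>z\<in>copies r. ?M (Inl x) z * partial_dperm \<beta> ?X (copies r - {z}) (?M(Inl x := ?M z))) =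
      (\<Sum>j\<in>UNIV. \<Sum>k=1..r j. u x j * partial_dperm \<beta> ?X (copies (r(j := r j - 1)))
        (colour_matrix (b(x := v j)) (u(x := a j)) v a))"
    unfolding sum_copies
  proof (intro sum.cong refl)
    fix j k assume "k \<in> {1..r j}"
    then show "?M (Inl x) (Inr (j, k)) * partial_dperm \<beta> ?X (copies r - {Inr (j, k)}) (?M(Inl x := ?M (Inr (j, k)))) =
      u x j * partial_dperm \<beta> ?X (copies (r(j := r j - 1))) (colour_matrix (b(x := v j)) (u(x := a j)) v a)"
      using assms(1) by (simp add: colour_matrix_upd_row partial_dperm_remove_copy)
  qed
  finally show ?thesis by (simp add: colour_matrix_upd_row)
qed

context
  fixes \<beta> :: "('v, 'a :: field_char_0) mfps" and X :: "'m set"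
    and v :: "'n :: finite \<Rightarrow> 'm \<Rightarrow> ('v, 'a) mfps" and a :: "'n \<Rightarrow> 'n \<Rightarrow> ('v, 'a) mfps"
  assumes finite_X: "finite X" and order_a: "\<And>i j. mfps_order_ge 1 (a i j)"
begin

lemma copy_sum_row_add:
  assumes "x \<in> X" "\<And>y j. y \<in> X \<Longrightarrow> mfps_order_ge 1 (u y j)"
    "\<And>j. mfps_order_ge 1 (u1 j)" "\<And>j. mfps_order_ge 1 (u2 j)"
  shows "copy_sum \<beta> X (b(x := \<lambda>y. b1 y + b2 y)) (u(x := \<lambda>j. u1 j + u2 j)) v a =
    copy_sum \<beta> X (b(x := b1)) (u(x := u1)) v a + copy_sum \<beta> X (b(x := b2)) (u(x := u2)) v a"
proof -
  have "partial_dperm \<beta> (Inl ` X) (copies r)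
        (colour_matrix (b(x := \<lambda>y. b1 y + b2 y)) (u(x := \<lambda>j. u1 j + u2 j)) v a) =
      partial_dperm \<beta> (Inl ` X) (copies r) (colour_matrix (b(x := b1)) (u(x := u1)) v a) +
      partial_dperm \<beta> (Inl ` X) (copies r) (colour_matrix (b(x := b2)) (u(x := u2)) v a)" for r
  proof -
    have "colour_row (\<lambda>y. b1 y + b2 y) (\<lambda>j. u1 j + u2 j) = (\<lambda>z. colour_row b1 u1 z + colour_row b2 u2 z)"
      by (auto simp: colour_row_def fun_eq_iff split: sum.splits)
    then show ?thesis
      unfolding colour_matrix_upd_row[symmetric]
      using assms(1) finite_X by (simp add: partial_dperm_row_add)
  qed
  moreover have "((\<lambda>r. mfps_const (1 / multi_fact r) *
        partial_dperm \<beta> (Inl ` X) (copies r) (colour_matrix (b(x := b1)) (u(x := u1)) v a) +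
      mfps_const (1 / multi_fact r) *
        partial_dperm \<beta> (Inl ` X) (copies r) (colour_matrix (b(x := b2)) (u(x := u2)) v a)) has_sum
      copy_sum \<beta> X (b(x := b1)) (u(x := u1)) v a + copy_sum \<beta> X (b(x := b2)) (u(x := u2)) v a) UNIV"
    by (intro has_sum_add has_sum_copy_sum) (use assms finite_X order_a in auto)
  ultimately show ?thesis
    unfolding copy_sum_def[of _ _ "b(x := \<lambda>y. b1 y + b2 y)"] by (simp add: distrib_left infsumI)
qed

lemma copy_sum_row_scale:
  assumes "x \<in> X" "\<And>y j. y \<in> X \<Longrightarrow> mfps_order_ge 1 (u y j)" "\<And>j. mfps_order_ge 1 (u1 j)"
  shows "copy_sum \<beta> X (b(x := \<lambda>y. c * b1 y)) (u(x := \<lambda>j. c * u1 j)) v a =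
    c * copy_sum \<beta> X (b(x := b1)) (u(x := u1)) v a"
proof -
  have "partial_dperm \<beta> (Inl ` X) (copies r)
        (colour_matrix (b(x := \<lambda>y. c * b1 y)) (u(x := \<lambda>j. c * u1 j)) v a) =
      c * partial_dperm \<beta> (Inl ` X) (copies r) (colour_matrix (b(x := b1)) (u(x := u1)) v a)" for r
  proof -
    have "colour_row (\<lambda>y. c * b1 y) (\<lambda>j. c * u1 j) = (\<lambda>z. c * colour_row b1 u1 z)"
      by (auto simp: colour_row_def fun_eq_iff split: sum.splits)
    then show ?thesis
      unfolding colour_matrix_upd_row[symmetric]
      using assms(1) finite_X by (simp add: partial_dperm_row_scale)
  qed
  moreover have "((\<lambda>r. c * (mfps_const (1 / multi_fact r) *
        partial_dperm \<beta> (Inl ` X) (copies r) (colour_matrix (b(x := b1)) (u(x := u1)) v a))) has_sum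
      c * copy_sum \<beta> X (b(x := b1)) (u(x := u1)) v a) UNIV"
    by (intro has_sum_cmult_right has_sum_copy_sum) (use assms finite_X order_a in auto)
  ultimately show ?thesis
    unfolding copy_sum_def[of _ _ "b(x := \<lambda>y. c * b1 y)"] by (simp add: mult.left_commute infsumI)
qed

lemma copy_sum_row_sum:
  assumes "x \<in> X" "\<And>y j. y \<in> X \<Longrightarrow> mfps_order_ge 1 (u y j)"
    "\<And>l j. mfps_order_ge 1 (u1 l j)" "finite L"
  shows "copy_sum \<beta> X (b(x := \<lambda>y. \<Sum>l\<in>L. c l * b1 l y)) (u(x := \<lambda>j. \<Sum>l\<in>L. c l * u1 l j)) v a =
    (\<Sum>l\<in>L. c l * copy_sum \<beta> X (b(x := b1 l)) (u(x := u1 l)) v a)"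
  using assms(4)
proof induction
  case empty
  have "copy_sum \<beta> X (b(x := \<lambda>y. 0 * b y y)) (u(x := \<lambda>j. 0 * 0)) v a =
      0 * copy_sum \<beta> X (b(x := \<lambda>y. b y y)) (u(x := \<lambda>j. 0)) v a"
    by (rule copy_sum_row_scale) (use assms(1,2) in \<open>auto simp: mfps_order_ge_def zero_mfps.rep_eq\<close>)
  then show ?case by (simp only: sum.empty mult_zero_left)
next
  case (insert l L)
  have ord: "mfps_order_ge 1 (c l * u1 l j)" for l j
    using mfps_order_ge_mult[of 0 "c l" 1 "u1 l j"] assms(3) by simp
  have "copy_sum \<beta> X (b(x := \<lambda>y. c l * b1 l y + (\<Sum>l\<in>L. c l * b1 l y)))
      (u(x := \<lambda>j. c l * u1 l j + (\<Sum>l\<in>L. c l * u1 l j))) v a =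
    copy_sum \<beta> X (b(x := \<lambda>y. c l * b1 l y)) (u(x := \<lambda>j. c l * u1 l j)) v a +
    copy_sum \<beta> X (b(x := \<lambda>y. \<Sum>l\<in>L. c l * b1 l y)) (u(x := \<lambda>j. \<Sum>l\<in>L. c l * u1 l j)) v a"
    by (rule copy_sum_row_add) (use assms ord in \<open>auto intro: mfps_order_ge_sum\<close>)
  also have "copy_sum \<beta> X (b(x := \<lambda>y. c l * b1 l y)) (u(x := \<lambda>j. c l * u1 l j)) v a =
      c l * copy_sum \<beta> X (b(x := b1 l)) (u(x := u1 l)) v a"
    by (rule copy_sum_row_scale) (use assms in auto)
  finally show ?case
    by (simp only: sum.insert[OF insert.hyps] insert.IH)
qed

text \<open>
  One step of the walk that starts at \<open>x\<close>: either \<open>x\<close> is mapped to a primed index, or it enters some copy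
  of colour \<open>j\<close> with weight \<open>u x j\<close> and continues from there with the row of \<open>j\<close>.
\<close>

lemma copy_sum_step:
  assumes "x \<in> X" "\<And>y j. y \<in> X \<Longrightarrow> mfps_order_ge 1 (u y j)"
  shows "copy_sum \<beta> X b u v a = copy_sum \<beta> X b (u(x := \<lambda>j. 0)) v a +
    copy_sum \<beta> X (b(x := \<lambda>y. \<Sum>j\<in>UNIV. u x j * v j y)) (u(x := \<lambda>i. \<Sum>j\<in>UNIV. u x j * a j i)) v a"
proof -
  let ?P = "\<lambda>r b' u'. partial_dperm \<beta> (Inl ` X) (copies r) (colour_matrix b' u' v a)"
  let ?S = "\<lambda>j. copy_sum \<beta> X (b(x := v j)) (u(x := a j)) v a"
  let ?T = "\<lambda>r j. mfps_const (of_nat (r j) / multi_fact r) * (u x j * ?P (r(j := r j - 1)) (b(x := v j)) (u(x := a j)))"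
  have zero: "mfps_order_ge 1 (0 :: ('v, 'a) mfps)" by (simp add: mfps_order_ge_def zero_mfps.rep_eq)
  have "((\<lambda>r. ?T r j) has_sum u x j * ?S j) UNIV" for j
  proof (rule sum_reindex_decrease)
    have "((\<lambda>r. u x j * (mfps_const (1 / multi_fact r) * ?P r (b(x := v j)) (u(x := a j)))) has_sum u x j * ?S j) UNIV"
      by (intro has_sum_cmult_right has_sum_copy_sum) (use assms finite_X order_a in auto)
    then show "((\<lambda>r. mfps_const (1 / multi_fact r) * (u x j * ?P r (b(x := v j)) (u(x := a j)))) has_sum u x j * ?S j) UNIV"
      by (simp add: mult.left_commute)
  qed
  then have "((\<lambda>r. \<Sum>j\<in>UNIV. ?T r j) has_sum (\<Sum>j\<in>UNIV. u x j * ?S j)) UNIV"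
    by (intro has_sum_sum) auto
  moreover have "((\<lambda>r. mfps_const (1 / multi_fact r) * ?P r b (u(x := \<lambda>j. 0))) has_sum
      copy_sum \<beta> X b (u(x := \<lambda>j. 0)) v a) UNIV"
    by (intro has_sum_copy_sum) (use assms finite_X order_a zero in auto)
  ultimately have "((\<lambda>r. mfps_const (1 / multi_fact r) * ?P r b (u(x := \<lambda>j. 0)) + (\<Sum>j\<in>UNIV. ?T r j)) has_sum
      copy_sum \<beta> X b (u(x := \<lambda>j. 0)) v a + (\<Sum>j\<in>UNIV. u x j * ?S j)) UNIV"
    by (rule has_sum_add[rotated])
  moreover have "mfps_const (1 / multi_fact r) * ?P r b (u(x := \<lambda>j. 0)) + (\<Sum>j\<in>UNIV. ?T r j) =
      mfps_const (1 / multi_fact r) * ?P r b u" for r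
  proof -
    have c: "mfps_const (of_nat (r j) / multi_fact r) =
        mfps_const (1 / multi_fact r) * (of_nat (r j) :: ('v, 'a) mfps)" for j
      by (simp add: mfps_const_of_nat[symmetric] mfps_const_mult[symmetric])
    show ?thesis
      unfolding partial_dperm_peel_copies[OF finite_X assms(1), of \<beta> r b u] c
      by (simp add: distrib_left sum_distrib_left mult.assoc)
  qed
  ultimately have "copy_sum \<beta> X b u v a = copy_sum \<beta> X b (u(x := \<lambda>j. 0)) v a + (\<Sum>j\<in>UNIV. u x j * ?S j)"
    unfolding copy_sum_def[of _ _ b u] by (simp add: infsumI)
  also have "(\<Sum>j\<in>UNIV. u x j * ?S j) =
      copy_sum \<beta> X (b(x := \<lambda>y. \<Sum>j\<in>UNIV. u x j * v j y)) (u(x := \<lambda>i. \<Sum>j\<in>UNIV. u x j * a j i)) v a"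
    by (rule copy_sum_row_sum[symmetric]) (use assms order_a in auto)
  finally show ?thesis .
qed

context
  fixes g :: "'n \<Rightarrow> 'n \<Rightarrow> ('v, 'a) mfps"
  assumes resolvent: "\<And>i j. g i j = (if i = j then 1 else 0) + (\<Sum>k\<in>UNIV. g i k * a k j)"
begin

text \<open>
  Iterating \<open>copy_sum_step\<close> would produce the walks of all lengths one after another. Applying it once to
  the row \<open>w = u (I - A)\<^sup>-\<^sup>1\<close>, which satisfies \<open>w - w A = u\<close>, sums them all without passing to a limit.
\<close>

lemma copy_sum_resolve_row:
  assumes x: "x \<in> X" and u: "\<And>y j. y \<in> X \<Longrightarrow> mfps_order_ge 1 (u y j)"
  shows "copy_sum \<beta> X b u v a =
    copy_sum \<beta> X (b(x := \<lambda>y. b x y + (\<Sum>i\<in>UNIV. \<Sum>j\<in>UNIV. u x i * g i j * v j y))) (u(x := \<lambda>j. 0)) v a"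
proof -
  let ?L = "\<lambda>b' u'. copy_sum \<beta> X (b(x := b')) (u(x := u')) v a"
  define w where "w j = (\<Sum>i\<in>UNIV. u x i * g i j)" for j
  define wv where "wv y = (\<Sum>j\<in>UNIV. w j * v j y)" for y
  define wa where "wa k = (\<Sum>j\<in>UNIV. w j * a j k)" for k
  have ord0: "mfps_order_ge 1 (0 :: ('v, 'a) mfps)" by (simp add: mfps_order_ge_def zero_mfps.rep_eq)
  have ordm: "mfps_order_ge 1 (p * q)" if "mfps_order_ge 1 p" for p q :: "('v, 'a) mfps"
    using mfps_order_ge_mult[OF that, of 0 q] by simp
  have ordw: "mfps_order_ge 1 (w j)" for j
    unfolding w_def by (intro mfps_order_ge_sum ordm u x)
  have ordwa: "mfps_order_ge 1 (wa k)" for k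
    unfolding wa_def by (intro mfps_order_ge_sum ordm ordw)
  have w: "w j = u x j + wa j" for j
  proof -
    have "w j = (\<Sum>i\<in>UNIV. u x i * (if i = j then 1 else 0) + u x i * (\<Sum>k\<in>UNIV. g i k * a k j))"
      unfolding w_def by (subst resolvent) (simp add: distrib_left)
    also have "\<dots> = u x j + (\<Sum>i\<in>UNIV. u x i * (\<Sum>k\<in>UNIV. g i k * a k j))"
      by (simp add: sum.distrib if_distrib[of "\<lambda>t. _ * t"] cong: if_cong)
    also have "(\<Sum>i\<in>UNIV. u x i * (\<Sum>k\<in>UNIV. g i k * a k j)) = wa j"
      unfolding wa_def w_def sum_distrib_left sum_distrib_right by (subst sum.swap) (simp add: mult.assoc)
    finally show ?thesis .
  qed
  then have w_eq: "w = (\<lambda>j. u x j + wa j)" by auto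
  have add: "?L (\<lambda>y. b1 y + b2 y) (\<lambda>j. u1 j + u2 j) = ?L b1 u1 + ?L b2 u2"
    if "\<And>j. mfps_order_ge 1 (u1 j)" "\<And>j. mfps_order_ge 1 (u2 j)" for b1 b2 u1 u2
    using x u that by (rule copy_sum_row_add)
  \<comment> \<open>Two evaluations of the sum at the row \<open>(0, w)\<close>, by one step of the walk and by the splitting of \<open>w\<close>; the
    common part \<open>(0, wa)\<close> cancels.\<close>
  have "?L (\<lambda>y. 0) w = ?L (\<lambda>y. 0) (\<lambda>j. 0) + ?L wv wa"
    using copy_sum_step[of x "u(x := w)" "b(x := \<lambda>y. 0)"] x u ordw by (simp add: wv_def[abs_def] wa_def[abs_def])
  moreover have "?L (\<lambda>y. 0) w = ?L (\<lambda>y. 0) (u x) + ?L (\<lambda>y. 0) wa"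
    using add[of "u x" wa "\<lambda>y. 0" "\<lambda>y. 0"] u[OF x] ordwa unfolding w_eq by (simp del: fun_upd_apply)
  moreover have "?L wv wa = ?L wv (\<lambda>j. 0) + ?L (\<lambda>y. 0) wa"
    using add[of "\<lambda>j. 0" wa wv "\<lambda>y. 0"] ord0 ordwa by simp
  moreover have "?L (\<lambda>y. 0) (\<lambda>j. 0) = 0"
    using add[of "\<lambda>j. 0" "\<lambda>j. 0" "\<lambda>y. 0" "\<lambda>y. 0"] ord0 by simp
  ultimately have "?L (\<lambda>y. 0) (u x) = ?L wv (\<lambda>j. 0)" by simp
  moreover have "?L (b x) (u x) = ?L (b x) (\<lambda>j. 0) + ?L (\<lambda>y. 0) (u x)"
    using add[of "\<lambda>j. 0" "u x" "b x" "\<lambda>y. 0"] ord0 u[OF x] by simp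
  moreover have "?L (\<lambda>y. b x y + wv y) (\<lambda>j. 0) = ?L (b x) (\<lambda>j. 0) + ?L wv (\<lambda>j. 0)"
    using add[of "\<lambda>j. 0" "\<lambda>j. 0" "b x" wv] ord0 by simp
  ultimately have "?L (b x) (u x) = ?L (\<lambda>y. b x y + wv y) (\<lambda>j. 0)" by simp
  moreover have "wv y = (\<Sum>i\<in>UNIV. \<Sum>j\<in>UNIV. u x i * g i j * v j y)" for y
    unfolding wv_def w_def sum_distrib_right by (rule sum.swap)
  ultimately show ?thesis by simp
qed

text \<open>
  The rows of \<open>X\<close> are resolved one by one. Resolving a row does not interfere with the others, since the
  formula for row \<open>x\<close> involves no other row of \<open>b\<close> or \<open>u\<close>.
\<close>

lemma copy_sum_factor:
  assumes u: "\<And>x j. x \<in> X \<Longrightarrow> mfps_order_ge 1 (u x j)"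
  shows "copy_sum \<beta> X b u v a =
    ext_perm \<beta> X (\<lambda>x y. b x y + (\<Sum>i\<in>UNIV. \<Sum>j\<in>UNIV. u x i * g i j * v j y)) * copy_sum \<beta> {} b u v a"
proof -
  let ?bhat = "\<lambda>x y. b x y + (\<Sum>i\<in>UNIV. \<Sum>j\<in>UNIV. u x i * g i j * v j y)"
  let ?b = "\<lambda>Z x. if x \<in> Z then ?bhat x else b x" and ?u = "\<lambda>Z x j. if x \<in> Z then 0 else u x j"
  have zero: "mfps_order_ge 1 (0 :: ('v, 'a) mfps)" by (simp add: mfps_order_ge_def zero_mfps.rep_eq)
  have "copy_sum \<beta> X b u v a = copy_sum \<beta> X (?b Z) (?u Z) v a" if "Z \<subseteq> X" for Z
    using finite_subset[OF that finite_X] that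
  proof (induction Z)
    case empty
    show ?case by simp
  next
    case (insert x Z)
    have "copy_sum \<beta> X (?b Z) (?u Z) v a =
      copy_sum \<beta> X ((?b Z)(x := \<lambda>y. ?b Z x y + (\<Sum>i\<in>UNIV. \<Sum>j\<in>UNIV. ?u Z x i * g i j * v j y)))
        ((?u Z)(x := \<lambda>j. 0)) v a"
      by (rule copy_sum_resolve_row) (use insert.prems u zero in auto)
    also have "(?b Z)(x := \<lambda>y. ?b Z x y + (\<Sum>i\<in>UNIV. \<Sum>j\<in>UNIV. ?u Z x i * g i j * v j y)) = ?b (insert x Z)"
      using insert.hyps(2) by auto
    also have "(?u Z)(x := \<lambda>j. 0) = ?u (insert x Z)" by auto
    finally show ?case using insert by simp
  qed
  from this[of X] have "copy_sum \<beta> X b u v a = copy_sum \<beta> X (?b X) (?u X) v a" by simp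
  also have "\<dots> = copy_sum \<beta> X ?bhat (\<lambda>x j. 0) v a"
    by (rule copy_sum_cong) auto
  also have "\<dots> = ext_perm \<beta> X ?bhat * copy_sum \<beta> {} b u v a"
  proof -
    have "partial_dperm \<beta> (Inl ` X) (copies r) (colour_matrix ?bhat (\<lambda>x j. 0) v a) =
      ext_perm \<beta> X ?bhat * partial_dperm \<beta> (Inl ` {}) (copies r) (colour_matrix b u v a)" for r
    proof -
      have "partial_dperm \<beta> (Inl ` X) (copies r) (colour_matrix ?bhat (\<lambda>x j. 0) v a) =
          ext_perm \<beta> (Inl ` X) (colour_matrix ?bhat (\<lambda>x j. 0) v a) *
          partial_dperm \<beta> {} (copies r) (colour_matrix ?bhat (\<lambda>x j. 0) v a)"
        using finite_X copies_disjoint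
        by (intro partial_dperm_block_triangular) (auto simp: copies_def)
      also have "ext_perm \<beta> (Inl ` X) (colour_matrix ?bhat (\<lambda>x j. 0) v a) = ext_perm \<beta> X ?bhat"
        using finite_X by (intro ext_perm_relabel) auto
      also have "partial_dperm \<beta> {} (copies r) (colour_matrix ?bhat (\<lambda>x j. 0) v a) =
          partial_dperm \<beta> (Inl ` {}) (copies r) (colour_matrix b u v a)"
        unfolding image_empty by (rule partial_dperm_cong) (auto simp: copies_def)
      finally show ?thesis .
    qed
    moreover have "((\<lambda>r. ext_perm \<beta> X ?bhat * (mfps_const (1 / multi_fact r) *
        partial_dperm \<beta> (Inl ` {}) (copies r) (colour_matrix b u v a))) has_sum
      ext_perm \<beta> X ?bhat * copy_sum \<beta> {} b u v a) UNIV"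
      by (intro has_sum_cmult_right has_sum_copy_sum) (use order_a in auto)
    ultimately show ?thesis
      unfolding copy_sum_def[of _ _ ?bhat] by (simp add: mult.left_commute infsumI)
  qed
  finally show ?thesis .
qed

end

end


section \<open>The Euler operator\<close>

text \<open>
  The derivation \<open>\<Sum>v. v \<partial>/\<partial>v\<close> over the indeterminates \<open>v\<close> with \<open>P v\<close>.
\<close>

definition euler :: "('v \<Rightarrow> bool) \<Rightarrow> ('v, 'a :: comm_ring_1) mfps \<Rightarrow> ('v, 'a) mfps" where
  "euler P f = Abs_mfps (\<lambda>m. of_nat (size (filter_mset P m)) * mfps_nth f m)"

text \<open>
  The series without terms free of the \<open>P\<close>-indeterminates; they form a closed ideal. For the difference
  of two series this says that the two have the same initial value, all \<open>P\<close>-indeterminates set to zero.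
\<close>

definition vanishes_outside :: "('v \<Rightarrow> bool) \<Rightarrow> ('v, 'a :: comm_ring_1) mfps \<Rightarrow> bool" where
  "vanishes_outside P f \<longleftrightarrow> (\<forall>m. filter_mset P m = {#} \<longrightarrow> mfps_nth f m = 0)"

lemma euler_0 [simp]: "euler P 0 = 0"
  by (rule mfps_eqI) (simp add: euler_def zero_mfps.rep_eq)

lemma euler_add: "euler P (f + g) = euler P f + euler P g"
  by (rule mfps_eqI) (simp add: euler_def plus_mfps.rep_eq distrib_left)

lemma euler_uminus: "euler P (- f) = - euler P f"
  by (rule mfps_eqI) (simp add: euler_def uminus_mfps.rep_eq)

lemma euler_sum: "euler P (sum f X) = (\<Sum>x\<in>X. euler P (f x))"
  by (induction X rule: infinite_finite_induct) (auto simp: euler_add)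

lemma euler_const [simp]: "euler P (mfps_const c) = 0"
  by (rule mfps_eqI) (simp add: euler_def mfps_const.rep_eq zero_mfps.rep_eq)

lemma euler_1 [simp]: "euler P 1 = 0"
  by (rule mfps_eqI) (simp add: euler_def one_mfps.rep_eq zero_mfps.rep_eq)

lemma euler_var: "euler P (mfps_var v) = (if P v then mfps_var v else 0)"
  by (rule mfps_eqI) (simp add: euler_def mfps_var.rep_eq zero_mfps.rep_eq)

lemma euler_mult: "euler P (f * g) = euler P f * g + f * euler P g"
proof (rule mfps_eqI)
  fix m :: "'a multiset"
  have "mfps_nth (euler P (f * g)) m = (\<Sum>(a, b)\<in>{(a, b). a + b = m}.
      of_nat (size (filter_mset P m)) * (mfps_nth f a * mfps_nth g b))"
    by (simp add: euler_def times_mfps.rep_eq sum_distrib_left case_prod_unfold)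
  also have "\<dots> = (\<Sum>(a, b)\<in>{(a, b). a + b = m}.
      mfps_nth (euler P f) a * mfps_nth g b + mfps_nth f a * mfps_nth (euler P g) b)"
    by (rule sum.cong) (auto simp: euler_def algebra_simps)
  also have "\<dots> = mfps_nth (euler P f * g + f * euler P g) m"
    by (simp add: times_mfps.rep_eq plus_mfps.rep_eq sum.distrib case_prod_unfold)
  finally show "mfps_nth (euler P (f * g)) m = mfps_nth (euler P f * g + f * euler P g) m" .
qed

lemma euler_power: "euler P (f ^ Suc k) = of_nat (Suc k) * f ^ k * euler P f"
proof (induction k)
  case (Suc k)
  have "euler P (f ^ Suc (Suc k)) = euler P f * f ^ Suc k + f * euler P (f ^ Suc k)"
    by (simp only: power_Suc[of f "Suc k"] euler_mult)
  then show ?case unfolding Suc.IH by (simp add: algebra_simps)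
qed simp

lemma euler_power_zero: "euler P f = 0 \<Longrightarrow> euler P (f ^ k) = 0"
  by (cases k) (simp_all add: euler_power del: power_Suc)

lemma euler_prod_homogeneous:
  assumes "\<And>x. x \<in> X \<Longrightarrow> euler P (f x) = f x"
  shows "euler P (prod f X) = of_nat (card X) * prod f X"
  using assms
  by (induction X rule: infinite_finite_induct) (auto simp: euler_mult algebra_simps)

lemma has_sum_euler:
  fixes f :: "'i \<Rightarrow> ('v, 'a :: comm_ring_1) mfps"
  assumes "(f has_sum s) S"
  shows "((\<lambda>i. euler P (f i)) has_sum euler P s) S"
  unfolding has_sum_def tendsto_mfps_iff euler_sum[symmetric]
proof
  fix m
  have "\<forall>\<^sub>F X in finite_subsets_at_top S. mfps_nth (sum f X) m = mfps_nth s m"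
    using assms unfolding has_sum_def tendsto_mfps_iff by blast
  then show "\<forall>\<^sub>F X in finite_subsets_at_top S. mfps_nth (euler P (sum f X)) m = mfps_nth (euler P s) m"
    by eventually_elim (simp add: euler_def)
qed

lemma vanishes_outside_mult: "vanishes_outside P f \<Longrightarrow> vanishes_outside P (f * g)"
  unfolding vanishes_outside_def times_mfps.rep_eq by (auto intro!: sum.neutral)

lemma vanishes_outside_add: "vanishes_outside P f \<Longrightarrow> vanishes_outside P g \<Longrightarrow> vanishes_outside P (f + g)"
  by (simp add: vanishes_outside_def plus_mfps.rep_eq)

lemma vanishes_outside_sum: "(\<And>x. x \<in> X \<Longrightarrow> vanishes_outside P (f x)) \<Longrightarrow> vanishes_outside P (sum f X)"
  by (simp add: vanishes_outside_def mfps_nth_sum)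

lemma vanishes_outside_has_sum:
  fixes f :: "'i \<Rightarrow> ('v, 'a :: comm_ring_1) mfps"
  assumes "(f has_sum s) S" "\<And>i. i \<in> S \<Longrightarrow> vanishes_outside P (f i)"
  shows "vanishes_outside P s"
  using assms unfolding has_sum_mfps_iff vanishes_outside_def by auto

lemma vanishes_outside_homogeneous:
  fixes f :: "('v, 'a :: field_char_0) mfps"
  assumes "euler P f = of_nat k * f" "k > 0"
  shows "vanishes_outside P f"
  unfolding vanishes_outside_def
proof (intro allI impI)
  fix m :: "'v multiset" assume m: "filter_mset P m = {#}"
  have "of_nat k * f = (\<Sum>l<k. f)" by simp
  then have "mfps_nth (of_nat k * f) m = of_nat k * mfps_nth f m"
    by (simp only: mfps_nth_sum) simp
  moreover have "mfps_nth (euler P f) m = 0" using m by (simp add: euler_def)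
  ultimately show "mfps_nth f m = 0" using assms by simp
qed

text \<open>
  As \<open>h\<close> has positive \<open>P\<close>-degree, the coefficients of \<open>h f\<close> in \<open>P\<close>-degree \<open>d\<close> only involve coefficients of \<open>f\<close> in
  smaller \<open>P\<close>-degree, and \<open>D\<close> multiplies by \<open>d \<noteq> 0\<close>: the equation is a recursion.
\<close>

lemma euler_ode_unique:
  fixes f g h :: "('v, 'a :: field_char_0) mfps"
  assumes "euler P f = h * f" "euler P g = h * g" and h: "vanishes_outside P h"
    and init: "vanishes_outside P (f - g)"
  shows "f = g"
proof (rule mfps_eqI)
  fix m show "mfps_nth f m = mfps_nth g m"
  proof (induction "size (filter_mset P m)" arbitrary: m rule: less_induct)
    case less
    show ?case
    proof (cases "filter_mset P m = {#}")
      case True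
      then show ?thesis using init by (simp add: vanishes_outside_def minus_mfps.rep_eq)
    next
      case False
      have "mfps_nth h a * mfps_nth f b = mfps_nth h a * mfps_nth g b" if "a + b = m" for a b
      proof (cases "filter_mset P a = {#}")
        case True
        then show ?thesis using h by (simp add: vanishes_outside_def)
      next
        case False
        have "size (filter_mset P a) + size (filter_mset P b) = size (filter_mset P m)"
          using that by auto
        moreover have "size (filter_mset P a) > 0" using False by (metis nonempty_has_size)
        ultimately have "size (filter_mset P b) < size (filter_mset P m)" by linarith
        then show ?thesis using less by simp
      qed
      then have "mfps_nth (h * f) m = mfps_nth (h * g) m"
        unfolding times_mfps.rep_eq by (intro sum.cong) auto
      then have "mfps_nth (euler P f) m = mfps_nth (euler P g) m" by (simp add: assms(1,2))
      then show ?thesis using False by (auto simp: euler_def)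
    qed
  qed
qed

lemma has_sum_nat_shift:
  fixes f :: "nat \<Rightarrow> 'b :: topological_comm_monoid_add"
  assumes "((\<lambda>k. f (Suc k)) has_sum s) UNIV"
  shows "(f has_sum (f 0 + s)) UNIV"
proof -
  have "(f has_sum s) (range Suc)"
    using assms by (simp add: has_sum_reindex o_def)
  moreover have "(f has_sum f 0) {0}" by (rule has_sum_finiteI) auto
  ultimately have "(f has_sum (f 0 + s)) ({0} \<union> range Suc)"
    by (intro has_sum_Un_disjoint) auto
  moreover have "{0} \<union> range Suc = UNIV" by (auto simp: image_def intro: not0_implies_Suc)
  ultimately show ?thesis by simp
qed

lemma has_sum_mfps_exp:
  "mfps_nth f {#} = 0 \<Longrightarrow> ((\<lambda>k. mfps_const (1 / fact k) * f ^ k) has_sum mfps_exp f) UNIV"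
  unfolding mfps_exp_def by (intro has_sum_infsum summable_mfps_exp)

lemma euler_exp:
  fixes f :: "('v, 'a :: field_char_0) mfps"
  assumes "mfps_nth f {#} = 0"
  shows "euler P (mfps_exp f) = euler P f * mfps_exp f"
proof -
  let ?t = "\<lambda>k. mfps_const (1 / fact k) * f ^ k"
  have step: "euler P (?t (Suc k)) = euler P f * ?t k" for k
  proof -
    have "mfps_const (1 / fact (Suc k)) * of_nat (Suc k) = (mfps_const (1 / fact k) :: ('v, 'a) mfps)"
      unfolding mfps_const_of_nat[symmetric] mfps_const_mult[symmetric]
      by (simp add: field_simps del: of_nat_Suc)
    then have "mfps_const (1 / fact (Suc k)) * (of_nat (Suc k) * f ^ k * euler P f) = 
        mfps_const (1 / fact k) * (f ^ k * euler P f)"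
      by (metis mult.assoc)
    then show ?thesis
      by (simp only: euler_mult euler_power euler_const) (simp add: ac_simps)
  qed
  have "((\<lambda>k. euler P f * ?t k) has_sum euler P f * mfps_exp f) UNIV"
    by (intro has_sum_cmult_right has_sum_mfps_exp assms)
  then have "((\<lambda>k. euler P (?t (Suc k))) has_sum euler P f * mfps_exp f) UNIV"
    unfolding step .
  then have "((\<lambda>k. euler P (?t k)) has_sum euler P (?t 0) + euler P f * mfps_exp f) UNIV"
    by (rule has_sum_nat_shift)
  moreover have "((\<lambda>k. euler P (?t k)) has_sum euler P (mfps_exp f)) UNIV"
    by (intro has_sum_euler has_sum_mfps_exp assms)
  ultimately show ?thesis using has_sum_unique by fastforce
qed

lemma vanishes_outside_exp:
  fixes f :: "('v, 'a :: field_char_0) mfps"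
  assumes "vanishes_outside P f"
  shows "vanishes_outside P (mfps_exp f - 1)"
proof -
  have f0: "mfps_nth f {#} = 0" using assms by (simp add: vanishes_outside_def)
  let ?t = "\<lambda>k. mfps_const (1 / fact k) * f ^ k"
  have "(\<lambda>k. ?t (Suc k)) summable_on UNIV"
  proof (rule summable_mfps_order, rule mfps_order_ge_const_mult)
    fix k
    have "mfps_order_ge (Suc k) (f ^ Suc k)"
      using f0 by (intro mfps_order_ge_power) (simp add: mfps_order_ge_1_iff)
    then show "mfps_order_ge k (f ^ Suc k)" by (rule mfps_order_ge_mono) simp
  qed
  then obtain s where s: "((\<lambda>k. ?t (Suc k)) has_sum s) UNIV"
    by (auto simp: summable_on_def)
  then have "(?t has_sum ?t 0 + s) UNIV" by (rule has_sum_nat_shift)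
  then have "mfps_exp f = 1 + s"
    using has_sum_mfps_exp[OF f0] has_sum_unique by fastforce
  moreover have "vanishes_outside P s"
  proof (rule vanishes_outside_has_sum[OF s])
    fix k
    have "vanishes_outside P (f * (f ^ k * mfps_const (1 / fact (Suc k))))"
      using assms by (rule vanishes_outside_mult)
    then show "vanishes_outside P (?t (Suc k))" by (simp only: power_Suc ac_simps)
  qed
  ultimately show ?thesis by simp
qed


section \<open>The geometric and the logarithmic series of a matrix\<close>

lemma matrix_pow_Suc_right: "matrix_pow A (Suc k) = matrix_pow A k ** A"
proof (induction k)
  case (Suc k)
  have "matrix_pow A (Suc (Suc k)) = A ** (matrix_pow A k ** A)" using Suc by simp
  then show ?case by (simp add: matrix_mul_assoc)
qed simp

lemma has_sum_matrix_geom_series: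
  fixes A :: "('v, 'a :: comm_ring_1) mfps ^ 'n ^ 'n"
  assumes "\<And>i j. mfps_nth (A $ i $ j) {#} = 0"
  shows "((\<lambda>k. matrix_pow A k $ i $ j) has_sum matrix_geom_series A $ i $ j) UNIV"
  using assms by (simp add: matrix_geom_series_def summable_matrix_geom_series)

text \<open>
  The variant of \<open>G = I + A G\<close> with \<open>A\<close> on the right: rows of \<open>U\<close> are multiplied by \<open>G\<close> from the right, so it is
  \<open>G - G A = I\<close> that makes \<open>w = u G\<close> solve \<open>w - w A = u\<close>.
\<close>

lemma matrix_geom_series_resolvent:
  fixes A :: "('v, 'a :: comm_ring_1) mfps ^ 'n ^ 'n"
  assumes "\<And>i j. mfps_nth (A $ i $ j) {#} = 0"
  shows "matrix_geom_series A = mat 1 + matrix_geom_series A ** A"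
proof -
  have "matrix_geom_series A $ i $ j = (mat 1 + matrix_geom_series A ** A) $ i $ j" for i j
  proof -
    have "((\<lambda>t. \<Sum>k\<in>UNIV. matrix_pow A t $ i $ k * A $ k $ j) has_sum
        (\<Sum>k\<in>UNIV. matrix_geom_series A $ i $ k * A $ k $ j)) UNIV"
      by (intro has_sum_sum has_sum_cmult_left has_sum_matrix_geom_series assms) auto
    then have "((\<lambda>t. matrix_pow A (Suc t) $ i $ j) has_sum (matrix_geom_series A ** A) $ i $ j) UNIV"
      unfolding matrix_pow_Suc_right by (simp add: matrix_matrix_mult_def)
    from has_sum_nat_shift[OF this]
    have "((\<lambda>t. matrix_pow A t $ i $ j) has_sum (mat 1 + matrix_geom_series A ** A) $ i $ j) UNIV"
      by simp
    then show ?thesis using has_sum_matrix_geom_series[OF assms] has_sum_unique by blast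
  qed
  then show ?thesis by (simp add: vec_eq_iff)
qed

lemma matrix_geom_series_resolvent_entry:
  fixes A :: "('v, 'a :: comm_ring_1) mfps ^ 'n ^ 'n"
  assumes "\<And>i j. mfps_nth (A $ i $ j) {#} = 0"
  shows "matrix_geom_series A $ i $ j =
    (if i = j then 1 else 0) + (\<Sum>k\<in>UNIV. matrix_geom_series A $ i $ k * A $ k $ j)"
  by (subst matrix_geom_series_resolvent[OF assms]) (simp add: mat_def matrix_matrix_mult_def)

text \<open>
  The series \<open>- log det (I - A)\<close>.
\<close>

definition log_series :: "('v, 'a :: field_char_0) mfps ^ 'n ^ 'n \<Rightarrow> ('v, 'a) mfps" where
  "log_series A = (\<Sum>\<^sub>\<infinity>t\<in>{1..}. mfps_const (1 / of_nat t) * trace (matrix_pow A t))"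

context
  fixes A :: "('v, 'a :: field_char_0) mfps ^ 'n ^ 'n" and P :: "'v \<Rightarrow> bool"
  assumes euler_A: "\<And>i j. euler P (A $ i $ j) = A $ i $ j"
begin

lemma vanishes_A: "vanishes_outside P (A $ i $ j)"
  by (rule vanishes_outside_homogeneous[where k = 1]) (simp_all add: euler_A)

lemma constant_term_A: "mfps_nth (A $ i $ j) {#} = 0"
  using vanishes_A by (simp add: vanishes_outside_def)

lemma euler_matrix_pow: "euler P (matrix_pow A k $ i $ j) = of_nat k * matrix_pow A k $ i $ j"
proof (induction k arbitrary: i j)
  case 0
  show ?case by (simp add: mat_def)
next
  case (Suc k)
  have "euler P (A $ i $ l * matrix_pow A k $ l $ j) = of_nat (Suc k) * (A $ i $ l * matrix_pow A k $ l $ j)" for l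
    by (simp add: euler_mult Suc euler_A algebra_simps)
  then show ?case
    by (simp add: matrix_matrix_mult_def euler_sum sum_distrib_left del: of_nat_Suc)
qed

lemma euler_trace_matrix_pow: "euler P (trace (matrix_pow A k)) = of_nat k * trace (matrix_pow A k)"
  by (simp add: trace_def euler_sum euler_matrix_pow sum_distrib_left)

lemma has_sum_log_series:
  "((\<lambda>t. mfps_const (1 / of_nat (Suc t)) * trace (matrix_pow A (Suc t))) has_sum log_series A) UNIV"
proof -
  have "((\<lambda>t. mfps_const (1 / of_nat t) * trace (matrix_pow A t)) has_sum log_series A) {1..}"
    unfolding log_series_def by (intro has_sum_infsum summable_trace_series constant_term_A)
  moreover have "{1..} = range Suc"
    by (force simp: image_iff Suc_le_eq gr0_conv_Suc)
  ultimately show ?thesis by (simp add: has_sum_reindex o_def del: of_nat_Suc)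
qed

lemma vanishes_log_series: "vanishes_outside P (log_series A)"
proof (rule vanishes_outside_has_sum[OF has_sum_log_series])
  fix t
  have "vanishes_outside P (trace (matrix_pow A (Suc t)))"
    using euler_trace_matrix_pow by (rule vanishes_outside_homogeneous) simp
  then show "vanishes_outside P (mfps_const (1 / of_nat (Suc t)) * trace (matrix_pow A (Suc t)))"
    by (subst mult.commute) (rule vanishes_outside_mult)
qed

text \<open>
  Since \<open>Tr (A\<^sup>t)\<close> is homogeneous of degree \<open>t\<close>, the denominators cancel and a geometric series remains.
\<close>

lemma euler_log_series: "euler P (log_series A) = trace (A ** matrix_geom_series A)"
proof -
  have "euler P (mfps_const (1 / of_nat (Suc t)) * trace (matrix_pow A (Suc t))) =
      trace (matrix_pow A (Suc t))" for t
  proof -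
    have "mfps_const (1 / of_nat (Suc t)) * of_nat (Suc t) = (1 :: ('v, 'a) mfps)"
      unfolding mfps_const_of_nat[symmetric] mfps_const_mult[symmetric]
      by (simp del: of_nat_Suc)
    then show ?thesis
      by (simp only: euler_mult euler_const euler_trace_matrix_pow mult.assoc[symmetric]) simp
  qed
  then have "((\<lambda>t. trace (matrix_pow A (Suc t))) has_sum euler P (log_series A)) UNIV"
    using has_sum_euler[OF has_sum_log_series, of P] by (simp only:)
  moreover have "((\<lambda>t. trace (matrix_pow A (Suc t))) has_sum trace (A ** matrix_geom_series A)) UNIV"
    unfolding trace_def matrix_pow.simps matrix_matrix_mult_def vec_lambda_beta
    by (intro has_sum_sum has_sum_cmult_right has_sum_matrix_geom_series constant_term_A) auto
  ultimately show ?thesis by (rule has_sum_unique)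
qed

text \<open>
  The logarithmic derivative of the determinant is \<open>\<beta> Tr (A G)\<close> with \<open>G = (I - A)\<^sup>-\<^sup>1\<close>; the exponential of
  \<open>- \<beta> Tr A\<close> lowers it to \<open>\<beta> (Tr (A G) - Tr A) = \<beta> Tr (A G A)\<close>.
\<close>

lemma det_side_ode:
  assumes "euler P \<beta> = 0"
  defines "F \<equiv> mfps_exp (- (\<beta> * trace A)) * det_neg_power \<beta> A"
  shows "euler P F = \<beta> * trace (A ** matrix_geom_series A ** A) * F"
    and "vanishes_outside P (F - 1)"
proof -
  let ?E1 = "mfps_exp (- (\<beta> * trace A))" and ?E2 = "mfps_exp (\<beta> * log_series A)"
  have F: "F = ?E1 * ?E2"
    unfolding F_def det_neg_power_def log_series_def ..
  have "vanishes_outside P (trace A * - \<beta>)"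
    unfolding trace_def by (intro vanishes_outside_mult vanishes_outside_sum vanishes_A)
  then have v1: "vanishes_outside P (- (\<beta> * trace A))" by (simp add: mult.commute)
  have v2: "vanishes_outside P (\<beta> * log_series A)"
    using vanishes_outside_mult[OF vanishes_log_series, of \<beta>] by (simp add: mult.commute)
  have c1: "mfps_nth (- (\<beta> * trace A)) {#} = 0" and c2: "mfps_nth (\<beta> * log_series A) {#} = 0"
    using v1 v2 by (simp_all add: vanishes_outside_def)
  have "euler P (trace A) = trace A" by (simp add: trace_def euler_sum euler_A)
  then have "euler P F = \<beta> * (trace (A ** matrix_geom_series A) - trace A) * F"
    unfolding F euler_mult euler_exp[OF c1] euler_exp[OF c2]
    by (simp add: euler_uminus euler_mult assms(1) euler_log_series algebra_simps)
  also have "trace (A ** matrix_geom_series A) - trace A = trace (A ** matrix_geom_series A ** A)"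
  proof -
    have "A ** matrix_geom_series A = A ** (mat 1 + matrix_geom_series A ** A)"
      using matrix_geom_series_resolvent[of A] constant_term_A by simp
    also have "\<dots> = A + A ** matrix_geom_series A ** A"
      by (simp add: matrix_add_ldistrib matrix_mul_assoc)
    finally have "trace (A ** matrix_geom_series A) = trace (A + A ** matrix_geom_series A ** A)"
      by simp
    then show ?thesis by (simp add: trace_add)
  qed
  finally show "euler P F = \<beta> * trace (A ** matrix_geom_series A ** A) * F" .
  have "F - 1 = (?E1 - 1) * ?E2 + (?E2 - 1)" by (simp add: F algebra_simps)
  moreover have "vanishes_outside P \<dots>"
    by (intro vanishes_outside_add vanishes_outside_mult vanishes_outside_exp v1 v2)
  ultimately show "vanishes_outside P (F - 1)" by (simp only:)
qed

end


section \<open>The sum without distinguished indices\<close>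

lemma ext_perm_empty [simp]: "ext_perm \<beta> {} M = 1"
  by (simp add: ext_perm_def num_cycles_def)

lemma ext_perm_singleton: "ext_perm \<beta> {x} M = \<beta> * M x x"
  by (simp add: ext_perm_expand_row[of "{x}" x])

text \<open>
  A marked copy of colour \<open>i\<close> moves to the primed indices under the name \<open>x\<close>. It still may not be fixed;
  therefore its diagonal entry is zero rather than \<open>a i i\<close>.
\<close>

lemma partial_dperm_mark_copy:
  fixes r :: "'n :: finite \<Rightarrow> nat" and a :: "'n \<Rightarrow> 'n \<Rightarrow> 'a :: comm_ring_1"
    and b :: "'m \<Rightarrow> 'm \<Rightarrow> 'a" and x :: 'm
  assumes "r i > 0"
  shows "partial_dperm \<beta> {} (copies r) (colour_matrix b u v a) =
    partial_dperm \<beta> (Inl ` {x}) (copies (r(i := r i - 1))) (colour_matrix (\<lambda>_ _. 0) (\<lambda>_. a i) (\<lambda>k _. a k i) a)"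
proof -
  let ?z = "Inr (i, r i) :: 'm + 'n \<times> nat" and ?r' = "r(i := r i - 1)"
  let ?M = "colour_matrix b u v a" and ?N = "colour_matrix (\<lambda>_ _. 0) (\<lambda>_. a i) (\<lambda>k _. a k i) a"
  let ?M' = "?M(?z := (?M ?z)(?z := 0))"
  let ?h = "Transposition.transpose ?z (Inl x)"
  have z: "?z \<in> copies r" using assms by (auto simp: copies_def)
  have z': "?z \<notin> copies ?r'" using copies_decrease[of r i] by blast
  have x': "Inl x \<notin> copies ?r'" by (auto simp: copies_def)
  have copies: "copies r = {?z} \<union> copies ?r'"
    using z copies_decrease[of r i] by blast
  have "partial_dperm \<beta> {} (copies r) ?M = partial_dperm \<beta> ({} \<union> {?z}) (copies ?r') ?M'"
    unfolding copies by (rule partial_dperm_zero_diag) (use z' in auto)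
  also have "\<dots> = partial_dperm \<beta> (?h ` {?z}) (?h ` copies ?r') ?N"
    unfolding Un_empty_left
  proof (rule partial_dperm_relabel[symmetric])
    fix p q assume pq: "p \<in> {?z} \<union> copies ?r'" "q \<in> {?z} \<union> copies ?r'"
    have *: "p = ?z \<or> (\<exists>k c. p = Inr (k, c) \<and> p \<noteq> ?z \<and> ?h p = p)" if "p \<in> {?z} \<union> copies ?r'" for p
      using that z' x' by (auto simp: copies_def transpose_apply_other)
    show "?N (?h p) (?h q) = ?M' p q"
      using *[OF pq(1)] *[OF pq(2)] by auto
  next
    show "inj_on ?h ({?z} \<union> copies ?r')" by (rule inj_on_subset[OF _ subset_UNIV]) simp
  qed (use z' in auto)
  also have "?h ` copies ?r' = copies ?r'"
    by (rule transpose_image_eq) (simp only: z' x')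
  finally show ?thesis by simp
qed

text \<open>
  Every copy contributes one entry of \<open>A\<close> to each product, so the term is homogeneous of degree \<open>\<Sum>i. r i\<close>.
\<close>

lemma euler_partial_dperm_copies:
  fixes a :: "'n :: finite \<Rightarrow> 'n \<Rightarrow> ('v, 'a :: comm_ring_1) mfps" and b :: "'m \<Rightarrow> 'm \<Rightarrow> ('v, 'a) mfps"
  assumes "euler P \<beta> = 0" "\<And>i j. euler P (a i j) = a i j"
  shows "euler P (partial_dperm \<beta> {} (copies r) (colour_matrix b u v a)) =
    of_nat (\<Sum>i\<in>UNIV. r i) * partial_dperm \<beta> {} (copies r) (colour_matrix b u v a)"
  unfolding partial_dperm_def euler_sum sum_distrib_left
proof (rule sum.cong[OF refl])
  fix \<pi> :: "'m + 'n \<times> nat \<Rightarrow> _"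
  assume "\<pi> \<in> {\<pi>. \<pi> permutes {} \<union> copies r \<and> (\<forall>y\<in>copies r. \<pi> y \<noteq> y)}"
  then have \<pi>: "\<pi> permutes copies r" by simp
  let ?M = "colour_matrix b u v a"
  have "euler P (?M x (\<pi> x)) = ?M x (\<pi> x)" if "x \<in> copies r" for x
  proof -
    have "\<pi> x \<in> copies r" using \<pi> that by (simp add: permutes_in_image)
    with that show ?thesis by (auto simp: copies_def assms(2))
  qed
  then have "euler P (\<Prod>x\<in>copies r. ?M x (\<pi> x)) = of_nat (\<Sum>i\<in>UNIV. r i) * (\<Prod>x\<in>copies r. ?M x (\<pi> x))"
    by (subst euler_prod_homogeneous) (auto simp: card_copies)
  then show "euler P (\<beta> ^ num_cycles ({} \<union> copies r) \<pi> * (\<Prod>x\<in>{} \<union> copies r. ?M x (\<pi> x))) =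
      of_nat (\<Sum>i\<in>UNIV. r i) * (\<beta> ^ num_cycles ({} \<union> copies r) \<pi> * (\<Prod>x\<in>{} \<union> copies r. ?M x (\<pi> x)))"
    by (simp add: euler_mult euler_power_zero assms(1) ac_simps)
qed

context
  fixes \<beta> :: "('v, 'a :: field_char_0) mfps" and a :: "'n :: finite \<Rightarrow> 'n \<Rightarrow> ('v, 'a) mfps"
    and P :: "'v \<Rightarrow> bool"
  assumes euler_\<beta>: "euler P \<beta> = 0" and euler_a: "\<And>i j. euler P (a i j) = a i j"
begin

lemma order_a: "mfps_order_ge 1 (a i j)"
  using vanishes_outside_homogeneous[of P "a i j" 1]
  by (simp add: euler_a mfps_order_ge_1_iff vanishes_outside_def)

text \<open>
  After marking, the sum has a single primed index. Its resolved diagonal entry collects the closed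
  walks from the marked copy back to itself that visit at least one further copy, with weight
  \<open>(A G A)\<^sub>i\<^sub>i\<close>, and its only cycle contributes one factor \<open>\<beta>\<close>.
\<close>

lemma copy_sum_empty_ode:
  fixes b :: "'m \<Rightarrow> 'm \<Rightarrow> ('v, 'a) mfps" and g :: "'n \<Rightarrow> 'n \<Rightarrow> ('v, 'a) mfps"
  assumes resolvent: "\<And>i j. g i j = (if i = j then 1 else 0) + (\<Sum>k\<in>UNIV. g i k * a k j)"
  shows "euler P (copy_sum \<beta> {} b u v a) =
    \<beta> * (\<Sum>i\<in>UNIV. \<Sum>j\<in>UNIV. \<Sum>k\<in>UNIV. a i j * g j k * a k i) * copy_sum \<beta> {} b u v a"
proof -
  let ?D = "\<lambda>r. partial_dperm \<beta> {} (copies r) (colour_matrix b u v a)"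
  let ?N = "\<lambda>i :: 'n. colour_matrix (\<lambda>_ _. 0) (\<lambda>_. a i) (\<lambda>k _. a k i) a :: 'm + 'n \<times> nat \<Rightarrow> _"
  let ?S = "\<lambda>i. copy_sum \<beta> {undefined :: 'm} (\<lambda>_ _. 0) (\<lambda>_. a i) (\<lambda>k _. a k i) a"
  have "((\<lambda>r. mfps_const (of_nat (r i) / multi_fact r) * ?D r) has_sum ?S i) UNIV" for i
  proof -
    have "((\<lambda>r. mfps_const (of_nat (r i) / multi_fact r) *
        partial_dperm \<beta> (Inl ` {undefined}) (copies (r(i := r i - 1))) (?N i)) has_sum ?S i) UNIV"
      by (intro sum_reindex_decrease[of "\<lambda>r. partial_dperm \<beta> (Inl ` {undefined}) (copies r) (?N i)"]
          has_sum_copy_sum order_a) simp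
    moreover have "mfps_const (of_nat (r i) / multi_fact r) *
        partial_dperm \<beta> (Inl ` {undefined}) (copies (r(i := r i - 1))) (?N i) =
      mfps_const (of_nat (r i) / multi_fact r) * ?D r" for r
      \<comment> \<open>For \<open>r i = 0\<close> there is no copy to mark, but the coefficient vanishes.\<close>
      using partial_dperm_mark_copy[of r i \<beta> b u v a undefined] by (cases "r i = 0") simp_all
    ultimately show ?thesis by simp
  qed
  then have "((\<lambda>r. \<Sum>i\<in>UNIV. mfps_const (of_nat (r i) / multi_fact r) * ?D r) has_sum (\<Sum>i\<in>UNIV. ?S i)) UNIV"
    by (intro has_sum_sum) auto
  moreover have "(\<Sum>i\<in>UNIV. mfps_const (of_nat (r i) / multi_fact r) * ?D r) =
      euler P (mfps_const (1 / multi_fact r) * ?D r)" for r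
  proof -
    have c: "mfps_const (of_nat (r i) / multi_fact r) =
        mfps_const (1 / multi_fact r) * (of_nat (r i) :: ('v, 'a) mfps)" for i
      by (simp add: mfps_const_of_nat[symmetric] mfps_const_mult[symmetric])
    show ?thesis
      unfolding euler_mult euler_partial_dperm_copies[OF euler_\<beta> euler_a] c
      by (simp add: sum_distrib_left sum_distrib_right mult.assoc)
  qed
  moreover have "((\<lambda>r. euler P (mfps_const (1 / multi_fact r) * ?D r)) has_sum
      euler P (copy_sum \<beta> {} b u v a)) UNIV"
    using has_sum_copy_sum[of "{}" u a \<beta> b v, OF _ _ order_a] by (intro has_sum_euler) auto
  ultimately have "euler P (copy_sum \<beta> {} b u v a) = (\<Sum>i\<in>UNIV. ?S i)"
    using has_sum_unique by fastforce
  also have "\<dots> = (\<Sum>i\<in>UNIV. \<beta> * (\<Sum>j\<in>UNIV. \<Sum>k\<in>UNIV. a i j * g j k * a k i) * copy_sum \<beta> {} b u v a)"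
  proof (rule sum.cong[OF refl])
    fix i
    have "?S i = ext_perm \<beta> {undefined :: 'm} (\<lambda>x y. 0 + (\<Sum>j\<in>UNIV. \<Sum>k\<in>UNIV. a i j * g j k * a k i)) *
        copy_sum \<beta> {} (\<lambda>_ _ :: 'm. 0) (\<lambda>_. a i) (\<lambda>k _. a k i) a"
      by (rule copy_sum_factor[where a = a and g = g and u = "\<lambda>_. a i"])
        (rule finite.intros order_a resolvent)+
    also have "copy_sum \<beta> {} (\<lambda>_ _ :: 'm. 0) (\<lambda>_. a i) (\<lambda>k _. a k i) a = copy_sum \<beta> {} b u v a"
      by (rule copy_sum_cong) auto
    finally show "?S i = \<beta> * (\<Sum>j\<in>UNIV. \<Sum>k\<in>UNIV. a i j * g j k * a k i) * copy_sum \<beta> {} b u v a"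
      by (simp add: ext_perm_singleton)
  qed
  also have "\<dots> = \<beta> * (\<Sum>i\<in>UNIV. \<Sum>j\<in>UNIV. \<Sum>k\<in>UNIV. a i j * g j k * a k i) * copy_sum \<beta> {} b u v a"
    by (simp add: sum_distrib_left sum_distrib_right)
  finally show ?thesis .
qed

lemma copy_sum_empty_initial: "vanishes_outside P (copy_sum \<beta> {} b u v a - 1)"
proof -
  let ?t = "\<lambda>r. mfps_const (1 / multi_fact r) * partial_dperm \<beta> {} (copies r) (colour_matrix b u v a)"
  let ?d = "\<lambda>r :: 'n \<Rightarrow> nat. if r = (\<lambda>_. 0) then - 1 else 0 :: ('v, 'a) mfps"
  \<comment> \<open>Subtracting \<open>1\<close> removes the term of \<open>r = 0\<close>, which is the empty permutation; all others have
    positive degree.\<close>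
  have "(?d has_sum sum ?d {\<lambda>_. 0}) UNIV"
    by (subst has_sum_cong_neutral[of "{\<lambda>_. 0}" UNIV _ ?d]) (auto intro: has_sum_finiteI)
  then have "((\<lambda>r. ?t r + ?d r) has_sum (copy_sum \<beta> {} b u v a + - 1)) UNIV"
    using has_sum_copy_sum[of "{}" u a \<beta> b v, OF _ _ order_a] by (intro has_sum_add) auto
  then have "vanishes_outside P (copy_sum \<beta> {} b u v a + - 1)"
  proof (rule vanishes_outside_has_sum)
    fix r :: "'n \<Rightarrow> nat"
    show "vanishes_outside P (?t r + ?d r)"
    proof (cases "r = (\<lambda>_. 0)")
      case True
      have "?t r = 1"
        by (simp add: True copies_def multi_fact_def partial_dperm_empty_right)
      then show ?thesis using True by (simp add: vanishes_outside_def zero_mfps.rep_eq)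
    next
      case False
      have "vanishes_outside P (partial_dperm \<beta> {} (copies r) (colour_matrix b u v a))"
        using euler_partial_dperm_copies[OF euler_\<beta> euler_a]
        by (rule vanishes_outside_homogeneous) (use False in \<open>auto simp: fun_eq_iff intro: sum_pos2\<close>)
      then have "vanishes_outside P (?t r)"
        by (subst mult.commute) (rule vanishes_outside_mult)
      then show ?thesis using False by simp
    qed
  qed
  then show ?thesis by simp
qed

end

lemma copy_sum_empty_eq:
  fixes A :: "('v, 'a :: field_char_0) mfps ^ 'n ^ 'n"
  assumes "euler P \<beta> = 0" "\<And>i j. euler P (A $ i $ j) = A $ i $ j"
  shows "copy_sum \<beta> {} b u v (\<lambda>i j. A $ i $ j) = mfps_exp (- (\<beta> * trace A)) * det_neg_power \<beta> A"
    (is "?T = ?F")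
proof (rule euler_ode_unique)
  let ?G = "matrix_geom_series A"
  let ?h = "\<beta> * trace (A ** ?G ** A)"
  have "?G $ i $ j = (if i = j then 1 else 0) + (\<Sum>k\<in>UNIV. ?G $ i $ k * A $ k $ j)" for i j
    by (intro matrix_geom_series_resolvent_entry constant_term_A[of P] assms(2))
  from copy_sum_empty_ode[OF assms this]
  have T: "euler P ?T = \<beta> * (\<Sum>i\<in>UNIV. \<Sum>j\<in>UNIV. \<Sum>k\<in>UNIV. A $ i $ j * ?G $ j $ k * A $ k $ i) * ?T" .
  have "(\<Sum>j\<in>UNIV. \<Sum>k\<in>UNIV. A $ i $ j * ?G $ j $ k * A $ k $ i) = (A ** ?G ** A) $ i $ i" for i
    unfolding matrix_matrix_mult_def vec_lambda_beta sum_distrib_right by (rule sum.swap)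
  then show "euler P ?T = ?h * ?T" using T by (simp add: trace_def)
  note F = det_side_ode[of P A \<beta>, OF assms(2) assms(1)]
  show "euler P ?F = ?h * ?F" by (rule F(1))
  have "vanishes_outside P (trace (A ** ?G ** A) * \<beta>)"
    unfolding trace_def matrix_matrix_mult_def vec_lambda_beta
    by (intro vanishes_outside_mult vanishes_outside_sum vanishes_A assms)
  then show "vanishes_outside P ?h" by (simp add: mult.commute)
  have "vanishes_outside P ((?T - 1) - (?F - 1))"
    using copy_sum_empty_initial[OF assms] F(2) by (simp add: vanishes_outside_def minus_mfps.rep_eq)
  then show "vanishes_outside P (?T - ?F)" by simp
qed

section \<open>The block matrix with labelled copies\<close>

text \<open>
  Removing the diagonal of \<open>B\<close> excludes the fixed primed indices, so that they may formally be permitted.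
  This is where \<open>B - diag B\<close> comes from, while the diagonal of \<open>U G V\<close> stays.
\<close>

lemma ext_dperm_block_eq:
  fixes B :: "'a :: comm_ring_1 ^ 'm :: finite ^ 'm" and A :: "'a ^ 'n :: finite ^ 'n"
  shows "ext_dperm \<beta> (block_index r) (block_matrix B U V A) =
    partial_dperm \<beta> (Inl ` UNIV) (copies r)
      (colour_matrix (\<lambda>x y. (B - diag_part B) $ x $ y) (\<lambda>x j. U $ x $ j) (\<lambda>i y. V $ i $ y) (\<lambda>i j. A $ i $ j))"
proof -
  have idx: "block_index r = Inl ` UNIV \<union> copies r"
    by (auto simp: block_index_def copies_def)
  have "ext_dperm \<beta> (block_index r) (block_matrix B U V A) =
      partial_dperm \<beta> {} (Inl ` UNIV \<union> copies r) (block_matrix B U V A)"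
    by (simp add: ext_dperm_def partial_dperm_def idx)
  also have "\<dots> = partial_dperm \<beta> ({} \<union> Inl ` UNIV) (copies r)
      (colour_matrix (\<lambda>x y. (B - diag_part B) $ x $ y) (\<lambda>x j. U $ x $ j) (\<lambda>i y. V $ i $ y) (\<lambda>i j. A $ i $ j))"
    by (rule partial_dperm_zero_diag) (auto simp: copies_def diag_part_def split: if_splits)
  finally show ?thesis by simp
qed

theorem theorem6p2:
  fixes \<beta> :: "(('n::finite, 'm::finite) indet, rat) mfps"
    and A :: "(('n, 'm) indet, rat) mfps ^ 'n ^ 'n"
    and B Bhat :: "(('n, 'm) indet, rat) mfps ^ 'm ^ 'm"
    and U :: "(('n, 'm) indet, rat) mfps ^ 'n ^ 'm"
    and V :: "(('n, 'm) indet, rat) mfps ^ 'm ^ 'n"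
  assumes "\<beta> = mfps_var Beta"
    and "A = (\<chi> i j. mfps_var (Ent_A i j))"
    and "B = (\<chi> i j. mfps_var (Ent_B i j))"
    and "U = (\<chi> i j. mfps_var (Ent_U i j))"
    and "V = (\<chi> i j. mfps_var (Ent_V i j))"
    and "Bhat = B - diag_part B + U ** matrix_geom_series A ** V"
  shows "((\<lambda>r :: 'n \<Rightarrow> nat. mfps_const (1 / (\<Prod>i\<in>UNIV. fact (r i))) *
            ext_dperm \<beta> (block_index r) (block_matrix B U V A))
          has_sum
            (mfps_exp (- (\<beta> * trace A)) * ext_perm \<beta> UNIV (\<lambda>i j. Bhat $ i $ j) * det_neg_power \<beta> A))
          UNIV"
proof -
  let ?P = "\<lambda>x. \<exists>i j. x = Ent_A i j" and ?G = "matrix_geom_series A"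
  let ?b = "\<lambda>x y. (B - diag_part B) $ x $ y" and ?u = "\<lambda>x j. U $ x $ j" and ?v = "\<lambda>i y. V $ i $ y"
    and ?a = "\<lambda>i j. A $ i $ j"
  have euler_\<beta>: "euler ?P \<beta> = 0" by (simp add: assms(1) euler_var)
  have euler_A: "euler ?P (A $ i $ j) = A $ i $ j" for i j by (auto simp: assms(2) euler_var)
  have ord_A: "mfps_order_ge 1 (A $ i $ j)" for i j
    by (simp add: assms(2) mfps_order_ge_1_iff mfps_var.rep_eq)
  have ord_U: "mfps_order_ge 1 (U $ i $ j)" for i j
    by (simp add: assms(4) mfps_order_ge_1_iff mfps_var.rep_eq)
  have res: "?G $ i $ j = (if i = j then 1 else 0) + (\<Sum>k\<in>UNIV. ?G $ i $ k * A $ k $ j)" for i j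
    by (intro matrix_geom_series_resolvent_entry constant_term_A[of ?P] euler_A)
  have "copy_sum \<beta> UNIV ?b ?u ?v ?a =
      ext_perm \<beta> UNIV (\<lambda>x y. ?b x y + (\<Sum>i\<in>UNIV. \<Sum>j\<in>UNIV. ?u x i * ?G $ i $ j * ?v j y)) * copy_sum \<beta> {} ?b ?u ?v ?a"
    by (rule copy_sum_factor[OF _ ord_A res ord_U]) simp
  also have "(\<lambda>x y. ?b x y + (\<Sum>i\<in>UNIV. \<Sum>j\<in>UNIV. ?u x i * ?G $ i $ j * ?v j y)) = (\<lambda>x y. Bhat $ x $ y)"
  proof (intro ext)
    fix x y
    have "(\<Sum>i\<in>UNIV. \<Sum>j\<in>UNIV. ?u x i * ?G $ i $ j * ?v j y) = (U ** ?G ** V) $ x $ y"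
      unfolding matrix_matrix_mult_def vec_lambda_beta sum_distrib_right by (rule sum.swap)
    then show "?b x y + (\<Sum>i\<in>UNIV. \<Sum>j\<in>UNIV. ?u x i * ?G $ i $ j * ?v j y) = Bhat $ x $ y"
      by (simp add: assms(6))
  qed
  also have "copy_sum \<beta> {} ?b ?u ?v ?a = mfps_exp (- (\<beta> * trace A)) * det_neg_power \<beta> A"
    by (rule copy_sum_empty_eq[OF euler_\<beta> euler_A])
  finally have "copy_sum \<beta> UNIV ?b ?u ?v ?a =
      mfps_exp (- (\<beta> * trace A)) * ext_perm \<beta> UNIV (\<lambda>i j. Bhat $ i $ j) * det_neg_power \<beta> A"
    by (simp only: ac_simps)
  moreover have "((\<lambda>r. mfps_const (1 / multi_fact r) *
      partial_dperm \<beta> (Inl ` UNIV) (copies r) (colour_matrix ?b ?u ?v ?a)) has_sum copy_sum \<beta> UNIV ?b ?u ?v ?a) UNIV"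
    by (intro has_sum_copy_sum ord_A ord_U) simp
  ultimately show ?thesis
    unfolding ext_dperm_block_eq multi_fact_def by (simp only:)
qed

end
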